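(* Let $\mathfrak{M}=(V,\langle\cdot,\cdot\rangle,A)$ be a Riemannian $0$-model (i.e. a $0$-model with $\langle\cdot,\cdot\rangle$ positive definite). Then $\mathfrak{M}$ is Puffini--Videv if and only if $\mathfrak{M}=\mathfrak{M}_1\oplus\dots\oplus\mathfrak{M}_k$ for some $0$-models $\mathfrak{M}_i$ each of which is Einstein.
   Context: A $0$-model $\mathfrak{M}=(V,\langle\cdot,\cdot\rangle,A)$ consists of a finite dimensional real vector space $V$, a non-degenerate symmetric inner product $\langle\cdot,\cdot\rangle$ on $V$, and an algebraic curvature tensor $A\in\otimes^4V^*$, i.e. for all $v_i\in V$: $A(v_1,v_2,v_3,v_4)=A(v_3,v_4,v_1,v_2)=-A(v_2,v_1,v_3,v_4)$ and $A(v_1,v_2,v_3,v_4)+A(v_2,v_3,v_1,v_4)+A(v_3,v_1,v_2,v_4)=0$. The curvature operator $\mathcal{A}$ is defined by $\langle\mathcal{A}(v_1,v_2)v_3,v_4\rangle=A(v_1,v_2,v_3,v_4)$, and the Jacobi operator by $\langle\mathcal{J}(v_1)v_2,v_3\rangle=A(v_2,v_1,v_1,v_3)$, i.e. $\mathcal{J}(v)w=\mathcal{A}(w,v)v$. Its polarization is $\mathcal{J}(v_1,v_2)v_3=\frac12\{\mathcal{A}(v_3,v_1)v_2+\mathcal{A}(v_3,v_2)v_1\}$, so $\mathcal{J}(v,v)=\mathcal{J}(v)$. If $v_1,\dots,v_k$ is a basis of a non-degenerate $k$-plane $\pi\subset V$, put $\xi_{ij}=\langle v_i,v_j\rangle$,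 let $\xi^{ij}$ be the inverse matrix, and define the higher order Jacobi operator $\mathcal{J}(\pi)=\sum_{i,j=1}^k\xi^{ij}\mathcal{J}(v_i,v_j)$; it is independent of the basis (and $\mathcal{J}(\{0\})=0$). The Ricci operator is $\rho=\mathcal{J}(V)$. $\mathfrak{M}$ is Puffini--Videv if $\mathcal{J}(\pi)\mathcal{J}(\pi^\perp)=\mathcal{J}(\pi^\perp)\mathcal{J}(\pi)$ for every non-degenerate subspace $\pi$ of $V$; equivalently, if $\mathcal{J}(\pi)\rho=\rho\mathcal{J}(\pi)$ for every non-degenerate subspace $\pi$. $\mathfrak{M}$ is Einstein if $\rho$ is a scalar multiple of the identity. One writes $\mathfrak{M}=\mathfrak{M}_1\oplus\dots\oplus\mathfrak{M}_k$ (where $k\ge1$; $k=1$ allowed) if there is an orthogonal direct sum decomposition $V=V_1\oplus\dots\oplus V_k$ with $A=A_1\oplus\dots\oplus A_k$, where $A_i=A|_{V_i}\in\otimes^4V_i^*$ (i.e. $A(x_1,x_2,x_3,x_4)=0$ whenever each $x_j$ lies in some $V_i$ but not all four lie in the same $V_i$), and $\mathfrak{M}_i=(V_i,\langle\cdot,\cdot\rangle|_{V_i},A_i)$. *)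

theory Defs
  imports Complex_Main "HOL-Library.FuncSet"
begin

text \<open>
  The vector space \<open>V\<close> of a 0-model is a finite dimensional linear subspace of an arbitrary real
  vector space \<open>'a\<close> (possibly all of it, possibly \<open>{0}\<close>), so that a model and its summands live in
  the same type. The inner product and the curvature tensor are total functions of which only the
  values on \<open>V\<close> are meaningful.
\<close>

record 'a model =
  m_space :: "'a set"
  m_inner :: "'a \<Rightarrow> 'a \<Rightarrow> real"
  m_tensor :: "'a \<Rightarrow> 'a \<Rightarrow> 'a \<Rightarrow> 'a \<Rightarrow> real"

definition functional_on :: "'a::real_vector set \<Rightarrow> ('a \<Rightarrow> real) \<Rightarrow> bool" where
  "functional_on V f \<longleftrightarrow>
     (\<forall>x\<in>V. \<forall>y\<in>V. f (x + y) = f x + f y) \<and> (\<forall>c. \<forall>x\<in>V. f (c *\<^sub>R x) = c * f x)"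

definition nondegenerate_on :: "('a::real_vector \<Rightarrow> 'a \<Rightarrow> real) \<Rightarrow> 'a set \<Rightarrow> bool" where
  "nondegenerate_on g W \<longleftrightarrow> (\<forall>x\<in>W. (\<forall>y\<in>W. g x y = 0) \<longrightarrow> x = 0)"

definition inner_product_on :: "'a::real_vector set \<Rightarrow> ('a \<Rightarrow> 'a \<Rightarrow> real) \<Rightarrow> bool" where
  "inner_product_on V g \<longleftrightarrow>
     (\<forall>y\<in>V. functional_on V (\<lambda>x. g x y)) \<and>
     (\<forall>x\<in>V. \<forall>y\<in>V. g x y = g y x) \<and>
     nondegenerate_on g V"

definition multilinear4_on ::
    "'a::real_vector set \<Rightarrow> ('a \<Rightarrow> 'a \<Rightarrow> 'a \<Rightarrow> 'a \<Rightarrow> real) \<Rightarrow> bool" where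
  "multilinear4_on V A \<longleftrightarrow>
     (\<forall>x\<in>V. \<forall>y\<in>V. \<forall>z\<in>V.
        functional_on V (\<lambda>w. A w x y z) \<and> functional_on V (\<lambda>w. A x w y z) \<and>
        functional_on V (\<lambda>w. A x y w z) \<and> functional_on V (\<lambda>w. A x y z w))"

definition curvature_tensor_on ::
    "'a::real_vector set \<Rightarrow> ('a \<Rightarrow> 'a \<Rightarrow> 'a \<Rightarrow> 'a \<Rightarrow> real) \<Rightarrow> bool" where
  "curvature_tensor_on V A \<longleftrightarrow>
     multilinear4_on V A \<and>
     (\<forall>v1\<in>V. \<forall>v2\<in>V. \<forall>v3\<in>V. \<forall>v4\<in>V.
        A v1 v2 v3 v4 = A v3 v4 v1 v2 \<and>
        A v1 v2 v3 v4 = - A v2 v1 v3 v4 \<and>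
        A v1 v2 v3 v4 + A v2 v3 v1 v4 + A v3 v1 v2 v4 = 0)"

definition zero_model :: "'a::real_vector model \<Rightarrow> bool" where
  "zero_model M \<longleftrightarrow>
     subspace (m_space M) \<and> (\<exists>B. finite B \<and> span B = m_space M) \<and>
     inner_product_on (m_space M) (m_inner M) \<and>
     curvature_tensor_on (m_space M) (m_tensor M)"

definition riemannian :: "'a::real_vector model \<Rightarrow> bool" where
  "riemannian M \<longleftrightarrow> (\<forall>x\<in>m_space M. x \<noteq> 0 \<longrightarrow> m_inner M x x > 0)"

definition curvature_op :: "'a::real_vector model \<Rightarrow> 'a \<Rightarrow> 'a \<Rightarrow> 'a \<Rightarrow> 'a" where
  "curvature_op M v1 v2 v3 =
     (THE u. u \<in> m_space M \<and> (\<forall>v4\<in>m_space M. m_inner M u v4 = m_tensor M v1 v2 v3 v4))"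

definition jacobi :: "'a::real_vector model \<Rightarrow> 'a \<Rightarrow> 'a \<Rightarrow> 'a" where
  "jacobi M v w = curvature_op M w v v"

definition jacobi2 :: "'a::real_vector model \<Rightarrow> 'a \<Rightarrow> 'a \<Rightarrow> 'a \<Rightarrow> 'a" where
  "jacobi2 M v1 v2 v3 = (1/2) *\<^sub>R (curvature_op M v3 v1 v2 + curvature_op M v3 v2 v1)"

lemma jacobi2_diag: "jacobi2 M v v = jacobi M v"
  by (rule ext) (simp add: jacobi2_def jacobi_def scaleR_2[symmetric])

definition is_basis_of :: "'a::real_vector set \<Rightarrow> 'a set \<Rightarrow> bool" where
  "is_basis_of B W \<longleftrightarrow> finite B \<and> independent B \<and> span B = W"

text \<open>
  The inverse of the Gram matrix of a basis; rows and columns are indexed by the basis vectors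
  themselves, and entries outside the index set are fixed to be \<open>0\<close>.
\<close>

definition gram_inverse :: "('a \<Rightarrow> 'a \<Rightarrow> real) \<Rightarrow> 'a set \<Rightarrow> 'a \<Rightarrow> 'a \<Rightarrow> real" where
  "gram_inverse g B =
     (THE h. (\<forall>u v. u \<notin> B \<or> v \<notin> B \<longrightarrow> h u v = 0) \<and>
        (\<forall>u\<in>B. \<forall>v\<in>B. (\<Sum>w\<in>B. g u w * h w v) = (if u = v then 1 else 0)) \<and>
        (\<forall>u\<in>B. \<forall>v\<in>B. (\<Sum>w\<in>B. h u w * g w v) = (if u = v then 1 else 0)))"

definition jacobi_basis :: "'a::real_vector model \<Rightarrow> 'a set \<Rightarrow> 'a \<Rightarrow> 'a" where
  "jacobi_basis M B x =
     (\<Sum>u\<in>B. \<Sum>v\<in>B. gram_inverse (m_inner M) B u v *\<^sub>R jacobi2 M u v x)"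

text \<open>
  For a non-degenerate subspace \<open>W\<close> of a 0-model the choice of basis does not matter. For
  \<open>W = {0}\<close> the only basis is \<open>{}\<close> and the operator is \<open>0\<close>.
\<close>

definition higher_jacobi :: "'a::real_vector model \<Rightarrow> 'a set \<Rightarrow> 'a \<Rightarrow> 'a" where
  "higher_jacobi M W = jacobi_basis M (SOME B. is_basis_of B W)"

definition ricci_op :: "'a::real_vector model \<Rightarrow> 'a \<Rightarrow> 'a" where
  "ricci_op M = higher_jacobi M (m_space M)"

definition perp :: "'a::real_vector model \<Rightarrow> 'a set \<Rightarrow> 'a set" where
  "perp M W = {x \<in> m_space M. \<forall>y\<in>W. m_inner M x y = 0}"

definition nondegenerate_subspace :: "'a::real_vector model \<Rightarrow> 'a set \<Rightarrow> bool" where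
  "nondegenerate_subspace M W \<longleftrightarrow>
     subspace W \<and> W \<subseteq> m_space M \<and> nondegenerate_on (m_inner M) W"

definition puffini_videv :: "'a::real_vector model \<Rightarrow> bool" where
  "puffini_videv M \<longleftrightarrow>
     (\<forall>W. nondegenerate_subspace M W \<longrightarrow>
        (\<forall>x\<in>m_space M. higher_jacobi M W (higher_jacobi M (perp M W) x) =
                      higher_jacobi M (perp M W) (higher_jacobi M W x)))"

definition einstein :: "'a::real_vector model \<Rightarrow> bool" where
  "einstein M \<longleftrightarrow> (\<exists>c. \<forall>x\<in>m_space M. ricci_op M x = c *\<^sub>R x)"

text \<open>
  \<open>M\<close> is the internal orthogonal direct sum of \<open>N 0, \<dots>, N (k - 1)\<close>: the structure of each summand
  is the restriction of that of \<open>M\<close>, and the tensor of \<open>M\<close> vanishes on vectors from summands that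
  are not all the same.
\<close>

definition is_direct_sum :: "'a::real_vector model \<Rightarrow> nat \<Rightarrow> (nat \<Rightarrow> 'a model) \<Rightarrow> bool" where
  "is_direct_sum M k N \<longleftrightarrow>
     (\<forall>i<k. subspace (m_space (N i)) \<and> m_space (N i) \<subseteq> m_space M) \<and>
     (\<forall>x\<in>m_space M. \<exists>!f. f \<in> (\<Pi>\<^sub>E i\<in>{..<k}. m_space (N i)) \<and> x = (\<Sum>i<k. f i)) \<and>
     (\<forall>i<k. \<forall>j<k. i \<noteq> j \<longrightarrow>
        (\<forall>x\<in>m_space (N i). \<forall>y\<in>m_space (N j). m_inner M x y = 0)) \<and>
     (\<forall>i<k. \<forall>x\<in>m_space (N i). \<forall>y\<in>m_space (N i). m_inner (N i) x y = m_inner M x y) \<and>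
     (\<forall>i<k. \<forall>x1\<in>m_space (N i). \<forall>x2\<in>m_space (N i). \<forall>x3\<in>m_space (N i). \<forall>x4\<in>m_space (N i).
        m_tensor (N i) x1 x2 x3 x4 = m_tensor M x1 x2 x3 x4) \<and>
     (\<forall>i1<k. \<forall>i2<k. \<forall>i3<k. \<forall>i4<k. \<not> (i1 = i2 \<and> i2 = i3 \<and> i3 = i4) \<longrightarrow>
        (\<forall>x1\<in>m_space (N i1). \<forall>x2\<in>m_space (N i2). \<forall>x3\<in>m_space (N i3). \<forall>x4\<in>m_space (N i4).
           m_tensor M x1 x2 x3 x4 = 0))"

end

theory Submission
  imports Defs
begin

text \<open>
  Write \<open>J W\<close> for the higher order Jacobi operator of a subspace \<open>W\<close> and \<open>\<rho>\<close> for the Ricci operator.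
  On an orthonormal basis \<open>E\<close> of \<open>W\<close> the Gram matrix disappears and
  \<open>\<langle>J W x, y\<rangle> = \<Sum>e\<in>E. A x e e y\<close> (\<open>g_higher_jacobi\<close>). Completing \<open>E\<close> by an orthonormal basis of the
  orthogonal complement shows that the Jacobi operators of \<open>W\<close> and of its complement add up to \<open>\<rho>\<close>,
  so they commute if and only if \<open>J W\<close> commutes with \<open>\<rho>\<close> (\<open>puffini_videv_iff_commutes_ricci\<close>).

  Suppose that every \<open>J W\<close> commutes with \<open>\<rho>\<close>. The symmetric operator \<open>\<rho>\<close> is diagonalisable, and its
  eigenspaces are the wanted summands. Taking for \<open>W\<close> a line gives \<open>A x v v y = 0\<close> whenever \<open>x\<close> and \<open>y\<close>
  belong to different eigenvalues. Polarising this in \<open>v\<close> and combining the result for different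
  pairs of arguments with the Bianchi identity kills \<open>A\<close> on eigenvectors that do not all belong to
  the same eigenvalue (\<open>curvature_mixed_eigenvectors\<close>, \<open>curvature_mixed\<close>). Hence \<open>A\<close> splits, and since
  the Ricci operator of a direct sum restricts to that of each summand (\<open>direct_sum_ricci\<close>), the
  summands are Einstein.

  Conversely, in a direct sum \<open>A x w w y = 0\<close> if \<open>x\<close> and \<open>y\<close> lie in different summands, so every
  \<open>J W\<close> preserves each summand. If the summands are Einstein, \<open>\<rho>\<close> is a scalar on each of them and
  therefore commutes with \<open>J W\<close>.

  The vector space carries no norm or topology; the diagonalisation of \<open>\<rho>\<close> is obtained from
  Gram--Schmidt orthonormalisation and the supremum of the Rayleigh quotient
  (\<open>rayleigh_extremal\<close>).
\<close>

section \<open>Functionals and bilinear forms on a subspace\<close>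

lemma functional_on_zero:
  assumes "subspace V" "functional_on V f"
  shows "f 0 = 0"
proof -
  have "f (0 *\<^sub>R 0) = 0 * f 0"
    using assms subspace_0 unfolding functional_on_def by blast
  then show ?thesis by simp
qed

lemma functional_on_diff:
  assumes "subspace V" "functional_on V f" "x \<in> V" "y \<in> V"
  shows "f (x - y) = f x - f y"
proof -
  have "f (x + (-1) *\<^sub>R y) = f x + (-1) * f y"
    using assms subspace_scale[of V y "-1"] unfolding functional_on_def by metis
  then show ?thesis by simp
qed

lemma functional_on_lincomb:
  assumes "subspace V" "functional_on V f" "\<And>e. e \<in> E \<Longrightarrow> v e \<in> V"
  shows "f (\<Sum>e\<in>E. c e *\<^sub>R v e) = (\<Sum>e\<in>E. c e * f (v e))"
  using assms(3)
proof (induction E rule: infinite_finite_induct)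
  case (insert a E)
  have "(\<Sum>e\<in>E. c e *\<^sub>R v e) \<in> V" "c a *\<^sub>R v a \<in> V"
    using insert assms(1) by (auto intro!: subspace_sum subspace_scale)
  then show ?case using insert assms(2) by (simp add: functional_on_def)
qed (auto simp: functional_on_zero[OF assms(1,2)])

lemma functional_on_sum:
  fixes v :: "'i \<Rightarrow> 'a::real_vector"
  assumes "subspace V" "functional_on V f" "\<And>e. e \<in> E \<Longrightarrow> v e \<in> V"
  shows "f (\<Sum>e\<in>E. v e) = (\<Sum>e\<in>E. f (v e))"
  using functional_on_lincomb[OF assms, where c = "\<lambda>_. 1"] by simp

lemma functional_on_subset: "functional_on V f \<Longrightarrow> W \<subseteq> V \<Longrightarrow> functional_on W f"
  unfolding functional_on_def by blast

definition bilinear_on :: "'a::real_vector set \<Rightarrow> ('a \<Rightarrow> 'a \<Rightarrow> real) \<Rightarrow> bool" where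
  "bilinear_on V S \<longleftrightarrow>
     (\<forall>x\<in>V. functional_on V (S x)) \<and> (\<forall>y\<in>V. functional_on V (\<lambda>x. S x y))"

lemma bilinear_on_right: "bilinear_on V S \<Longrightarrow> x \<in> V \<Longrightarrow> functional_on V (S x)"
  and bilinear_on_left: "bilinear_on V S \<Longrightarrow> y \<in> V \<Longrightarrow> functional_on V (\<lambda>x. S x y)"
  by (auto simp: bilinear_on_def)

lemma bilinear_on_subset: "bilinear_on V S \<Longrightarrow> W \<subseteq> V \<Longrightarrow> bilinear_on W S"
  unfolding bilinear_on_def by (blast intro: functional_on_subset)

lemma bilinear_on_lincomb:
  assumes "subspace V" "bilinear_on V S" "\<And>i. i \<in> I \<Longrightarrow> v i \<in> V" "\<And>j. j \<in> J \<Longrightarrow> w j \<in> V"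
  shows "S (\<Sum>i\<in>I. a i *\<^sub>R v i) (\<Sum>j\<in>J. b j *\<^sub>R w j) = (\<Sum>i\<in>I. \<Sum>j\<in>J. a i * b j * S (v i) (w j))"
proof -
  have "(\<Sum>j\<in>J. b j *\<^sub>R w j) \<in> V"
    using assms by (auto intro!: subspace_sum subspace_scale)
  then have "S (\<Sum>i\<in>I. a i *\<^sub>R v i) (\<Sum>j\<in>J. b j *\<^sub>R w j)
      = (\<Sum>i\<in>I. a i * S (v i) (\<Sum>j\<in>J. b j *\<^sub>R w j))"
    by (intro functional_on_lincomb[OF assms(1) bilinear_on_left[OF assms(2)]] assms(3))
  also have "\<dots> = (\<Sum>i\<in>I. a i * (\<Sum>j\<in>J. b j * S (v i) (w j)))"
    by (intro sum.cong refl arg_cong2[where f = "(*)"] assms(3,4)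
        functional_on_lincomb[OF assms(1) bilinear_on_right[OF assms(2)]])
  finally show ?thesis by (simp add: sum_distrib_left mult.assoc)
qed

definition orthonormal_basis :: "('a::real_vector \<Rightarrow> 'a \<Rightarrow> real) \<Rightarrow> 'a set \<Rightarrow> 'a set \<Rightarrow> bool" where
  "orthonormal_basis g E W \<longleftrightarrow>
     finite E \<and> (\<forall>e\<in>E. \<forall>f\<in>E. g e f = (if e = f then 1 else 0)) \<and> span E = W"

section \<open>Finite dimensional Euclidean spaces\<close>

locale euclidean_form =
  fixes V :: "'a::real_vector set" and g :: "'a \<Rightarrow> 'a \<Rightarrow> real"
  assumes sub: "subspace V"
    and fin_dim: "\<exists>B. finite B \<and> span B = V"
    and bil: "bilinear_on V g"
    and sym: "x \<in> V \<Longrightarrow> y \<in> V \<Longrightarrow> g x y = g y x"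
    and pos: "x \<in> V \<Longrightarrow> x \<noteq> 0 \<Longrightarrow> g x x > 0"
begin

lemmas mem_simps = subspace_0[OF sub] subspace_add[OF sub] subspace_diff[OF sub]
  subspace_scale[OF sub] subspace_sum[OF sub]

lemma g_add: "x \<in> V \<Longrightarrow> y \<in> V \<Longrightarrow> z \<in> V \<Longrightarrow> g (x + y) z = g x z + g y z"
  and g_scale: "x \<in> V \<Longrightarrow> z \<in> V \<Longrightarrow> g (c *\<^sub>R x) z = c * g x z"
  and g_scale_right: "x \<in> V \<Longrightarrow> z \<in> V \<Longrightarrow> g x (c *\<^sub>R z) = c * g x z"
  using bil unfolding bilinear_on_def functional_on_def by blast+

lemma g_diff: "x \<in> V \<Longrightarrow> y \<in> V \<Longrightarrow> z \<in> V \<Longrightarrow> g (x - y) z = g x z - g y z"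
  by (rule functional_on_diff[OF sub bilinear_on_left[OF bil]])

lemma g_zero: "z \<in> V \<Longrightarrow> g 0 z = 0"
  by (rule functional_on_zero[OF sub bilinear_on_left[OF bil]])

lemma g_sum: "(\<And>e. e \<in> E \<Longrightarrow> v e \<in> V) \<Longrightarrow> z \<in> V \<Longrightarrow> g (\<Sum>e\<in>E. v e) z = (\<Sum>e\<in>E. g (v e) z)"
  by (rule functional_on_sum[OF sub bilinear_on_left[OF bil]])

lemma g_lincomb:
  "(\<And>e. e \<in> E \<Longrightarrow> v e \<in> V) \<Longrightarrow> z \<in> V \<Longrightarrow> g (\<Sum>e\<in>E. c e *\<^sub>R v e) z = (\<Sum>e\<in>E. c e * g (v e) z)"
  by (rule functional_on_lincomb[OF sub bilinear_on_left[OF bil]])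

lemma g_pos_iff: "x \<in> V \<Longrightarrow> g x x = 0 \<longleftrightarrow> x = 0"
  using pos[of x] g_zero[of 0] mem_simps(1) by (cases "x = 0") auto

lemma g_nonneg: "x \<in> V \<Longrightarrow> g x x \<ge> 0"
  using pos[of x] g_pos_iff[of x] by (cases "x = 0") auto

lemma eq_by_inner:
  assumes "x \<in> V" "y \<in> V" "\<And>z. z \<in> V \<Longrightarrow> g x z = g y z"
  shows "x = y"
proof -
  have "g (x - y) (x - y) = 0" using assms(3)[of "x - y"] g_diff[of x y "x - y"] assms(1,2) mem_simps(3)[of x y] by simp
  then have "x - y = 0" using g_pos_iff mem_simps(3)[OF assms(1,2)] by blast
  then show ?thesis by simp
qed

lemma onb_subset: "orthonormal_basis g E W \<Longrightarrow> W \<subseteq> V \<Longrightarrow> E \<subseteq> V"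
  using span_superset[of E] by (auto simp: orthonormal_basis_def)

lemma onb_coeff:
  assumes "finite E" "\<forall>e\<in>E. \<forall>f\<in>E. g e f = (if e = f then 1 else 0)" "E \<subseteq> V" "f \<in> E"
  shows "g (\<Sum>e\<in>E. c e *\<^sub>R e) f = c f"
proof -
  have "g (\<Sum>e\<in>E. c e *\<^sub>R e) f = (\<Sum>e\<in>E. c e * g e f)"
    using assms by (intro g_lincomb) auto
  also have "\<dots> = (\<Sum>e\<in>E. if e = f then c f else 0)"
    using assms by (intro sum.cong) auto
  finally show ?thesis using assms by simp
qed

lemma onb_expand:
  assumes "orthonormal_basis g E V" "x \<in> V"
  shows "x = (\<Sum>e\<in>E. g x e *\<^sub>R e)"
proof -
  have E: "finite E" "\<forall>e\<in>E. \<forall>f\<in>E. g e f = (if e = f then 1 else 0)" "E \<subseteq> V" "span E = V"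
    using assms onb_subset[of E V] by (auto simp: orthonormal_basis_def)
  then obtain c where c: "x = (\<Sum>e\<in>E. c e *\<^sub>R e)"
    using assms(2) span_finite[of E] by auto
  have "g x f = c f" if "f \<in> E" for f
    unfolding c using onb_coeff[OF E(1-3) that] .
  then show ?thesis using c by (simp cong: sum.cong)
qed

lemma onb_independent:
  assumes "orthonormal_basis g E W" "W \<subseteq> V"
  shows "independent E"
proof -
  have E: "finite E" "\<forall>e\<in>E. \<forall>f\<in>E. g e f = (if e = f then 1 else 0)" "E \<subseteq> V"
    using assms onb_subset[of E W] by (auto simp: orthonormal_basis_def)
  have "c f = 0" if "(\<Sum>e\<in>E. c e *\<^sub>R e) = 0" "f \<in> E" for c f
    using onb_coeff[OF E that(2), of c] g_zero that E(3) by auto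
  then show ?thesis using dependent_finite[OF E(1)] by blast
qed

lemma dim_eq_card_onb:
  assumes "orthonormal_basis g E W" "W \<subseteq> V"
  shows "dim W = card E"
proof -
  have "dim (span E) = card E"
    by (simp add: dim_span dim_eq_card_independent[OF onb_independent[OF assms]])
  moreover have "span E = W" using assms(1) by (simp add: orthonormal_basis_def)
  ultimately show ?thesis by metis
qed

lemma gram_schmidt:
  assumes "finite B" "B \<subseteq> V"
  shows "\<exists>E. orthonormal_basis g E (span B)"
  using assms
proof (induction B rule: finite_induct)
  case empty
  then show ?case by (intro exI[of _ "{}"]) (auto simp: orthonormal_basis_def)
next
  case (insert b B)
  then obtain E where onb: "orthonormal_basis g E (span B)" by auto
  have "span B \<subseteq> V" using insert.prems sub by (simp add: span_minimal)
  then have E: "finite E" "\<forall>e\<in>E. \<forall>f\<in>E. g e f = (if e = f then 1 else 0)" "E \<subseteq> V"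
    "span E = span B"
    using onb onb_subset[of E "span B"] by (auto simp: orthonormal_basis_def)
  define p where "p = (\<Sum>e\<in>E. g b e *\<^sub>R e)"
  have p: "p \<in> span E" "p \<in> V" "b \<in> V"
    unfolding p_def using E(3) insert.prems
    by (auto intro!: span_sum span_scale mem_simps intro: span_base)
  have perp: "g (b - p) e = 0" if "e \<in> E" for e
    using that p E onb_coeff[OF E(1-3) that, of "g b"] g_diff[of b p e]
    by (auto simp: p_def)
  show ?case
  proof (cases "b = p")
    case True
    then have "span (insert b B) = span B"
      using p(1) E(4) by (simp add: span_redundant)
    then show ?thesis using onb by auto
  next
    case False
    define n where "n = (1 / sqrt (g (b - p) (b - p))) *\<^sub>R (b - p)"
    have q: "g (b - p) (b - p) > 0" "b - p \<in> V"
      using False p pos[of "b - p"] mem_simps(3)[of b p] by auto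
    have nV: "n \<in> V" using q by (simp add: n_def mem_simps)
    have "g n n = 1"
      using q by (simp add: n_def g_scale g_scale_right mem_simps)
    moreover have "g n e = 0" "g e n = 0" if "e \<in> E" for e
    proof -
      show "g n e = 0" using perp[OF that] q that E by (auto simp: n_def g_scale)
      then show "g e n = 0" using sym[of e n] nV that E by auto
    qed
    moreover have "span (insert n E) = span (insert b B)"
    proof -
      have 1: "b = sqrt (g (b - p) (b - p)) *\<^sub>R n + p" using q by (simp add: n_def)
      have 2: "p \<in> span (insert n E)" "p \<in> span (insert b B)"
        using p(1) E(4) span_mono[of E "insert n E"] span_mono[of B "insert b B"] by auto
      have "b \<in> span (insert n E)"
        by (subst 1) (intro span_add span_scale 2, auto intro: span_base)
      moreover have "n \<in> span (insert b B)"
        unfolding n_def by (intro span_scale span_diff 2) (auto intro: span_base)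
      moreover have "B \<subseteq> span (insert n E)" "E \<subseteq> span (insert b B)"
        using E(4) span_mono[of E "insert n E"] span_mono[of B "insert b B"]
          span_superset[of B] span_superset[of E] by blast+
      ultimately show ?thesis
        by (intro span_eq[THEN iffD2]) auto
    qed
    ultimately have "orthonormal_basis g (insert n E) (span (insert b B))"
      using E by (auto simp: orthonormal_basis_def)
    then show ?thesis by blast
  qed
qed

lemma subspace_form:
  assumes "subspace W" "W \<subseteq> V"
  shows "euclidean_form W g"
proof
  show "\<exists>B. finite B \<and> span B = W"
  proof -
    obtain B where B: "B \<subseteq> W" "independent B" "W \<subseteq> span B" by (rule basis_exists[of W])
    obtain C where C: "finite C" "span C = V" using fin_dim by blast
    have "B \<subseteq> span C" using B(1) assms(2) C(2) by simp
    then have "finite B" using independent_span_bound[OF C(1) B(2)] by simp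
    moreover have "span B = W" using B(3) span_minimal[OF B(1) assms(1)] by simp
    ultimately show ?thesis by blast
  qed
  show "bilinear_on W g" using bil assms(2) by (rule bilinear_on_subset)
  show "subspace W" by (rule assms)
  show "g x y = g y x" if "x \<in> W" "y \<in> W" for x y
    using that assms(2) by (intro sym) auto
  show "g x x > 0" if "x \<in> W" "x \<noteq> 0" for x
    using that assms(2) by (intro pos) auto
qed

lemma onb_exists:
  assumes "subspace W" "W \<subseteq> V"
  obtains E where "orthonormal_basis g E W"
proof -
  interpret W: euclidean_form W g by (rule subspace_form[OF assms])
  obtain B where "finite B" "span B = W" using W.fin_dim by blast
  then show ?thesis using W.gram_schmidt[of B] span_superset[of B] that by auto
qed

lemma subspace_perp: "E \<subseteq> V \<Longrightarrow> subspace {y \<in> V. \<forall>e\<in>E. g y e = 0}"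
  unfolding subspace_def by (auto simp: mem_simps g_zero g_add g_scale subset_iff)

lemma perp_span:
  assumes "E \<subseteq> V"
  shows "{y \<in> V. \<forall>e\<in>span E. g y e = 0} = {y \<in> V. \<forall>e\<in>E. g y e = 0}"
proof -
  have "g y e = 0" if "y \<in> V" "\<forall>e\<in>E. g y e = 0" "e \<in> span E" for y e
  proof -
    have "span E \<subseteq> {e \<in> V. \<forall>z\<in>{y}. g e z = 0}"
      using that assms sym[of y] by (intro span_minimal subspace_perp) (auto simp: subset_iff)
    then show ?thesis using that sym[of y e] by auto
  qed
  then show ?thesis using span_superset[of E] by blast
qed

lemma onb_Un_perp:
  assumes E: "orthonormal_basis g E W" "W \<subseteq> V"
    and F: "orthonormal_basis g F {y \<in> V. \<forall>e\<in>W. g y e = 0}"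
  shows "orthonormal_basis g (E \<union> F) V" "E \<inter> F = {}"
proof -
  have EV: "finite E" "\<forall>e\<in>E. \<forall>f\<in>E. g e f = (if e = f then 1 else 0)" "E \<subseteq> V" "span E = W"
    using E onb_subset[of E W] by (auto simp: orthonormal_basis_def)
  have FV: "F \<subseteq> {y \<in> V. \<forall>e\<in>W. g y e = 0}"
    using F span_superset[of F] by (auto simp: orthonormal_basis_def)
  have EW: "E \<subseteq> W" using EV(4) span_superset by blast
  have orth: "g f e = 0" "g e f = 0" if "e \<in> E" "f \<in> F" for e f
  proof -
    have "f \<in> V" "g f e = 0" using that EW FV by blast+
    moreover have "e \<in> V" using that EV(3) by blast
    ultimately show "g f e = 0" "g e f = 0" using sym[of e f] by simp_all
  qed
  show disj: "E \<inter> F = {}"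
  proof -
    have False if "e \<in> E" "e \<in> F" for e
      using orth(1)[OF that] EV(2) that(1) by simp
    then show ?thesis by blast
  qed
  have "span (E \<union> F) = V"
  proof
    show "span (E \<union> F) \<subseteq> V" using EV(3) FV sub by (intro span_minimal) auto
    show "V \<subseteq> span (E \<union> F)"
    proof
      fix x assume x: "x \<in> V"
      define p where "p = (\<Sum>e\<in>E. g x e *\<^sub>R e)"
      have p: "p \<in> span E" "p \<in> V"
        unfolding p_def using EV(3) by (auto intro!: span_sum span_scale mem_simps intro: span_base)
      have "g (x - p) e = 0" if "e \<in> E" for e
        using that p x EV onb_coeff[OF EV(1-3) that, of "g x"] g_diff[of x p e]
        by (auto simp: p_def)
      then have "x - p \<in> {y \<in> V. \<forall>e\<in>W. g y e = 0}"
        using perp_span[OF EV(3)] EV(4) p x mem_simps(3)[of x p] by auto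
      then have "x - p \<in> span F" using F by (simp add: orthonormal_basis_def)
      then have "p + (x - p) \<in> span (E \<union> F)"
        using p(1) span_mono[of E "E \<union> F"] span_mono[of F "E \<union> F"]
        by (intro span_add) auto
      then show "x \<in> span (E \<union> F)" by simp
    qed
  qed
  then show "orthonormal_basis g (E \<union> F) V"
    using EV F orth disj by (auto simp: orthonormal_basis_def)
qed

text \<open>
  If \<open>r e u\<close> are the coordinates of the orthonormal vectors \<open>e\<close> in the basis \<open>B\<close>, the inverse Gram
  matrix is \<open>\<Sum>e\<in>E. r e u * r e v\<close>, and inserting this into the double sum recombines the basis
  vectors to \<open>S e e\<close>. Thus the trace of a form is independent of the basis.
\<close>

lemma trace_gram_inverse:
  assumes B: "is_basis_of B V" and E: "orthonormal_basis g E V" and S: "bilinear_on V S"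
  shows "(\<Sum>u\<in>B. \<Sum>v\<in>B. gram_inverse g B u v * S u v) = (\<Sum>e\<in>E. S e e)"
proof -
  have finB: "finite B" and indB: "independent B" and spB: "span B = V"
    using B by (auto simp: is_basis_of_def)
  have BV: "B \<subseteq> V" using spB span_superset by blast
  have EV: "E \<subseteq> V" "finite E" using E onb_subset[of E V] by (auto simp: orthonormal_basis_def)
  define r where "r = representation B"
  define h where "h u v = (\<Sum>e\<in>E. r e u * r e v)" for u v
  have r: "e = (\<Sum>u\<in>B. r e u *\<^sub>R u)" if "e \<in> V" for e
    using sum_representation_eq[OF indB, of e B] that spB finB by (simp add: r_def)
  have h0: "h u v = 0" if "u \<notin> B \<or> v \<notin> B" for u v
  proof -
    have "r e u * r e v = 0" for e
      using that representation_ne_zero[of B e] by (auto simp: r_def)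
    then show ?thesis unfolding h_def by (intro sum.neutral) blast
  qed
  have hsym: "h u v = h v u" for u v by (simp add: h_def mult.commute)
  have left: "(\<Sum>w\<in>B. g u w * h w v) = (if u = v then 1 else 0)" if u: "u \<in> B" and v: "v \<in> B" for u v
  proof -
    have uV: "u \<in> V" using u BV by auto
    have "(\<Sum>w\<in>B. g u w * h w v) = (\<Sum>e\<in>E. \<Sum>w\<in>B. g u w * (r e w * r e v))"
      unfolding h_def sum_distrib_left by (rule sum.swap)
    also have "\<dots> = (\<Sum>e\<in>E. r e v * (\<Sum>w\<in>B. r e w * g u w))"
      by (simp add: sum_distrib_left mult_ac)
    also have "\<dots> = (\<Sum>e\<in>E. r e v * g u e)"
    proof (rule sum.cong[OF refl])
      fix e assume "e \<in> E"
      then have "g u e = g u (\<Sum>w\<in>B. r e w *\<^sub>R w)" using r[of e] EV by auto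
      also have "\<dots> = (\<Sum>w\<in>B. r e w * g u w)"
        using functional_on_lincomb[OF sub bilinear_on_right[OF bil uV], of B "\<lambda>w. w" "r e"] BV
        by auto
      finally show "r e v * (\<Sum>w\<in>B. r e w * g u w) = r e v * g u e" by simp
    qed
    also have "\<dots> = r (\<Sum>e\<in>E. g u e *\<^sub>R e) v"
    proof -
      have "r (\<Sum>e\<in>E. g u e *\<^sub>R e) = (\<lambda>b. \<Sum>e\<in>E. r (g u e *\<^sub>R e) b)"
        unfolding r_def using EV by (intro representation_sum[OF indB]) (auto simp: spB mem_simps)
      moreover have "r (g u e *\<^sub>R e) = (\<lambda>b. g u e * r e b)" if "e \<in> E" for e
        unfolding r_def using EV that by (intro representation_scale[OF indB]) (auto simp: spB)
      ultimately show ?thesis by (simp add: mult.commute)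
    qed
    also have "\<dots> = r u v" using onb_expand[OF E uV] by simp
    also have "\<dots> = (if u = v then 1 else 0)"
      unfolding r_def using representation_basis[OF indB u] by auto
    finally show ?thesis .
  qed
  have right: "(\<Sum>w\<in>B. h u w * g w v) = (if u = v then 1 else 0)" if "u \<in> B" "v \<in> B" for u v
  proof -
    have "(\<Sum>w\<in>B. h u w * g w v) = (\<Sum>w\<in>B. g v w * h w u)"
      using that BV hsym sym by (intro sum.cong) (auto simp: mult.commute subset_iff)
    then show ?thesis using left[OF that(2,1)] by auto
  qed
  have "gram_inverse g B = h"
    unfolding gram_inverse_def
  proof (rule the_equality)
    fix h'
    assume h': "(\<forall>u v. u \<notin> B \<or> v \<notin> B \<longrightarrow> h' u v = 0) \<and>
      (\<forall>u\<in>B. \<forall>v\<in>B. (\<Sum>w\<in>B. g u w * h' w v) = (if u = v then 1 else 0)) \<and>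
      (\<forall>u\<in>B. \<forall>v\<in>B. (\<Sum>w\<in>B. h' u w * g w v) = (if u = v then 1 else 0))"
    have "h' u v = h u v" for u v
    proof (cases "u \<in> B \<and> v \<in> B")
      case True
      then have u: "u \<in> B" and v: "v \<in> B" by auto
      have "h u v = (\<Sum>z\<in>B. (if u = z then 1 else 0) * h z v)"
        using u finB by (simp add: if_distrib[of "\<lambda>t. t * _"] cong: if_cong)
      also have "\<dots> = (\<Sum>z\<in>B. (\<Sum>w\<in>B. h' u w * g w z) * h z v)"
        using h' u by (intro sum.cong) auto
      also have "\<dots> = (\<Sum>w\<in>B. h' u w * (\<Sum>z\<in>B. g w z * h z v))"
        unfolding sum_distrib_left sum_distrib_right by (subst sum.swap) (simp add: mult_ac)
      also have "\<dots> = (\<Sum>w\<in>B. h' u w * (if w = v then 1 else 0))"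
        using left v by (intro sum.cong) auto
      also have "\<dots> = h' u v"
        using v finB by (simp add: if_distrib[of "\<lambda>t. _ * t"] cong: if_cong)
      finally show ?thesis by simp
    qed (use h' h0 in auto)
    then show "h' = h" by (intro ext)
  qed (intro conjI ballI allI impI h0 left right; assumption)
  then have "(\<Sum>u\<in>B. \<Sum>v\<in>B. gram_inverse g B u v * S u v)
      = (\<Sum>u\<in>B. \<Sum>v\<in>B. \<Sum>e\<in>E. r e u * r e v * S u v)"
    by (simp add: h_def sum_distrib_right)
  also have "\<dots> = (\<Sum>u\<in>B. \<Sum>e\<in>E. \<Sum>v\<in>B. r e u * r e v * S u v)"
    by (intro sum.cong refl sum.swap)
  also have "\<dots> = (\<Sum>e\<in>E. \<Sum>u\<in>B. \<Sum>v\<in>B. r e u * r e v * S u v)" by (rule sum.swap)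
  also have "\<dots> = (\<Sum>e\<in>E. S e e)"
  proof (rule sum.cong[OF refl])
    fix e assume "e \<in> E"
    then have e: "e = (\<Sum>u\<in>B. r e u *\<^sub>R u)" using r EV by auto
    have "S (\<Sum>u\<in>B. r e u *\<^sub>R u) (\<Sum>u\<in>B. r e u *\<^sub>R u) = (\<Sum>u\<in>B. \<Sum>v\<in>B. r e u * r e v * S u v)"
      using bilinear_on_lincomb[OF sub S, of B "\<lambda>u. u" B "\<lambda>u. u" "r e" "r e"] BV by auto
    then show "(\<Sum>u\<in>B. \<Sum>v\<in>B. r e u * r e v * S u v) = S e e" using e by simp
  qed
  finally show ?thesis .
qed

lemma riesz:
  assumes "functional_on V \<phi>"
  shows "\<exists>!u. u \<in> V \<and> (\<forall>y\<in>V. g u y = \<phi> y)"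
proof (rule ex_ex1I)
  obtain E where E: "orthonormal_basis g E V" using onb_exists[OF sub] by blast
  have EV: "E \<subseteq> V" using onb_subset[OF E] by simp
  have "g (\<Sum>e\<in>E. \<phi> e *\<^sub>R e) y = \<phi> y" if y: "y \<in> V" for y
  proof -
    have "g (\<Sum>e\<in>E. \<phi> e *\<^sub>R e) y = (\<Sum>e\<in>E. \<phi> e * g e y)"
      using EV y by (intro g_lincomb) auto
    also have "\<dots> = (\<Sum>e\<in>E. g y e * \<phi> e)"
      using EV y by (intro sum.cong) (auto simp: mult.commute sym subset_iff)
    also have "\<dots> = \<phi> (\<Sum>e\<in>E. g y e *\<^sub>R e)"
      using functional_on_lincomb[OF sub assms, of E "\<lambda>e. e" "g y"] EV
      by (simp add: subset_iff)
    finally show ?thesis using onb_expand[OF E y] by simp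
  qed
  moreover have "(\<Sum>e\<in>E. \<phi> e *\<^sub>R e) \<in> V" using EV by (auto intro!: mem_simps)
  ultimately show "\<exists>u. u \<in> V \<and> (\<forall>y\<in>V. g u y = \<phi> y)" by blast
qed (use eq_by_inner in auto)


section \<open>Diagonalising a symmetric form\<close>

text \<open>
  In coordinates with respect to an orthonormal basis every coefficient satisfies
  \<open>(g x e)\<^sup>2 \<le> g x x\<close>, so the sum of the absolute values of the matrix entries of \<open>S\<close> is a bound;
  the added \<open>1\<close> makes it positive.
\<close>

lemma form_dominated:
  assumes S: "bilinear_on V S"
  shows "\<exists>C>0. \<forall>x\<in>V. S x x \<le> C * g x x"
proof -
  obtain E where E: "orthonormal_basis g E V" using onb_exists[OF sub] by blast
  have EV: "finite E" "E \<subseteq> V" using E onb_subset[OF E] by (auto simp: orthonormal_basis_def)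
  define C where "C = 1 + (\<Sum>e\<in>E. \<Sum>f\<in>E. \<bar>S e f\<bar>)"
  have "C > 0" unfolding C_def by (intro add_pos_nonneg sum_nonneg) auto
  moreover have "S x x \<le> C * g x x" if x: "x \<in> V" for x
  proof -
    have parseval: "g x x = (\<Sum>e\<in>E. (g x e)\<^sup>2)"
    proof -
      have "g (\<Sum>e\<in>E. g x e *\<^sub>R e) x = (\<Sum>e\<in>E. g x e * g e x)"
        using EV x by (intro g_lincomb) auto
      also have "\<dots> = (\<Sum>e\<in>E. (g x e)\<^sup>2)"
        using EV x by (intro sum.cong) (auto simp: power2_eq_square sym subset_iff)
      finally show ?thesis using onb_expand[OF E x] by simp
    qed
    have coeff: "(g x e)\<^sup>2 \<le> g x x" if "e \<in> E" for e
      unfolding parseval using EV that by (intro member_le_sum) auto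
    have "S x x = S (\<Sum>e\<in>E. g x e *\<^sub>R e) (\<Sum>e\<in>E. g x e *\<^sub>R e)"
      using onb_expand[OF E x] by simp
    also have "\<dots> = (\<Sum>e\<in>E. \<Sum>f\<in>E. g x e * g x f * S e f)"
      using EV by (intro bilinear_on_lincomb[OF sub S]) auto
    also have "\<dots> \<le> (\<Sum>e\<in>E. \<Sum>f\<in>E. g x x * \<bar>S e f\<bar>)"
    proof (intro sum_mono)
      fix e f assume "e \<in> E" "f \<in> E"
      then have c: "(g x e)\<^sup>2 \<le> g x x" "(g x f)\<^sup>2 \<le> g x x" using coeff by auto
      have "2 * \<bar>g x e * g x f\<bar> \<le> (g x e)\<^sup>2 + (g x f)\<^sup>2"
        using sum_squares_bound[of "\<bar>g x e\<bar>" "\<bar>g x f\<bar>"] by (simp add: abs_mult)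
      then have "\<bar>g x e * g x f\<bar> \<le> g x x" using c by linarith
      then have "\<bar>g x e * g x f\<bar> * \<bar>S e f\<bar> \<le> g x x * \<bar>S e f\<bar>"
        by (intro mult_right_mono) auto
      then show "g x e * g x f * S e f \<le> g x x * \<bar>S e f\<bar>"
        by (metis abs_le_D1 abs_mult)
    qed
    also have "\<dots> = (C - 1) * g x x"
      by (simp add: C_def sum_distrib_left mult.commute)
    also have "\<dots> \<le> C * g x x"
      using g_nonneg[OF x] by (intro mult_right_mono) auto
    finally show ?thesis .
  qed
  ultimately show ?thesis by blast
qed

text \<open>
  This provides the inductive step of the spectral theorem. Let \<open>m\<close> be the supremum of the Rayleigh quotient \<open>S x x / g x x\<close>. Then \<open>P = m g - S\<close> is positive
  semidefinite. If it were definite it would dominate a positive multiple of \<open>g\<close>, and \<open>m\<close> could be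
  lowered; so \<open>P x x = 0\<close> for some \<open>x \<noteq> 0\<close>, which forces \<open>P x y = 0\<close> for all \<open>y\<close>. Domination of
  forms thus takes the place of the compactness of the unit sphere.
\<close>

lemma rayleigh_extremal:
  assumes S: "bilinear_on V S" and S_sym: "\<And>x y. x \<in> V \<Longrightarrow> y \<in> V \<Longrightarrow> S x y = S y x"
    and nontriv: "V \<noteq> {0}"
  shows "\<exists>x\<in>V. g x x = 1 \<and> (\<forall>y\<in>V. g x y = 0 \<longrightarrow> S x y = 0)"
proof -
  obtain v where v: "v \<in> V" "v \<noteq> 0" using nontriv mem_simps(1) by blast
  obtain C where C: "C > 0" "\<And>x. x \<in> V \<Longrightarrow> S x x \<le> C * g x x" using form_dominated[OF S] by blast
  define Q where "Q = {S x x / g x x |x. x \<in> V \<and> x \<noteq> 0}"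
  have "bdd_above Q"
  proof (rule bdd_aboveI)
    fix q assume "q \<in> Q"
    then obtain x where x: "x \<in> V" "x \<noteq> 0" "q = S x x / g x x" by (auto simp: Q_def)
    then show "q \<le> C" using C(2)[OF x(1)] pos[OF x(1,2)] by (simp add: pos_divide_le_eq)
  qed
  have "Q \<noteq> {}" using v by (auto simp: Q_def)
  define m where "m = Sup Q"
  define P where "P x y = m * g x y - S x y" for x y
  have P_bil: "bilinear_on V P"
    using S bil unfolding bilinear_on_def functional_on_def P_def by (auto simp: algebra_simps)
  have P_sym: "P x y = P y x" if "x \<in> V" "y \<in> V" for x y
    using that by (simp add: P_def sym[of x y] S_sym[of x y])
  have P_nonneg: "P x x \<ge> 0" if "x \<in> V" for x
  proof (cases "x = 0")
    case True
    then show ?thesis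
      using functional_on_zero[OF sub bilinear_on_right[OF P_bil that]] by simp
  next
    case False
    then have "S x x / g x x \<le> m"
      unfolding m_def using that \<open>bdd_above Q\<close> by (intro cSup_upper) (auto simp: Q_def)
    then show ?thesis using pos[OF that False] by (simp add: P_def divide_simps)
  qed
  have "\<exists>x\<in>V. x \<noteq> 0 \<and> P x x = 0"
  proof (rule ccontr)
    assume "\<not> ?thesis"
    then have definite: "P x x > 0" if "x \<in> V" "x \<noteq> 0" for x
      using P_nonneg[OF that(1)] that by force
    interpret P: euclidean_form V P
      by unfold_locales (use sub fin_dim P_bil P_sym definite in auto)
    obtain D where D: "D > 0" "\<And>x. x \<in> V \<Longrightarrow> g x x \<le> D * P x x"
      using P.form_dominated[OF bil] by blast
    have "q \<le> m - 1 / D" if "q \<in> Q" for q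
    proof -
      obtain x where x: "x \<in> V" "x \<noteq> 0" "q = S x x / g x x" using \<open>q \<in> Q\<close> by (auto simp: Q_def)
      have "g x x / D \<le> m * g x x - S x x"
        using D(2)[OF x(1)] D(1) by (simp add: P_def divide_simps mult.commute)
      then have "S x x \<le> (m - 1 / D) * g x x" by (simp add: algebra_simps)
      then show ?thesis using pos[OF x(1,2)] x(3) by (simp add: pos_divide_le_eq)
    qed
    then have "m \<le> m - 1 / D" unfolding m_def using \<open>Q \<noteq> {}\<close> by (intro cSup_least) auto
    then show False using D(1) by simp
  qed
  then obtain x where x: "x \<in> V" "x \<noteq> 0" "P x x = 0" by blast
  have null: "P x y = 0" if y: "y \<in> V" for y
  proof (rule ccontr)
    assume nz: "P x y \<noteq> 0"
    have quad: "P (y + t *\<^sub>R x) (y + t *\<^sub>R x) = P y y + 2 * t * P x y" for t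
    proof -
      have tx: "t *\<^sub>R x \<in> V" and ytx: "y + t *\<^sub>R x \<in> V" using x y by (auto simp: mem_simps)
      have "P (y + t *\<^sub>R x) (y + t *\<^sub>R x) = P y (y + t *\<^sub>R x) + P (t *\<^sub>R x) (y + t *\<^sub>R x)"
        using bilinear_on_left[OF P_bil ytx] y tx by (simp add: functional_on_def)
      also have "P (t *\<^sub>R x) (y + t *\<^sub>R x) = t * P x (y + t *\<^sub>R x)"
        using bilinear_on_left[OF P_bil ytx] x by (simp add: functional_on_def)
      also have "P x (y + t *\<^sub>R x) = P x y + t * P x x"
        using bilinear_on_right[OF P_bil x(1)] x y tx by (simp add: functional_on_def)
      also have "P y (y + t *\<^sub>R x) = P y y + t * P y x"
        using bilinear_on_right[OF P_bil y] x y tx by (simp add: functional_on_def)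
      finally show ?thesis using x(3) P_sym[OF y x(1)] by simp
    qed
    \<comment> \<open>At this \<open>t\<close> the affine function \<open>P y y + 2 * t * P x y\<close> takes the value \<open>-1\<close>.\<close>
    define t where "t = - (P y y + 1) / (2 * P x y)"
    have "0 \<le> P y y + 2 * t * P x y"
      unfolding quad[symmetric] using x y by (intro P_nonneg) (simp add: mem_simps)
    moreover have "2 * t * P x y = - (P y y + 1)" using nz by (simp add: t_def)
    ultimately show False by linarith
  qed
  define n where "n = (1 / sqrt (g x x)) *\<^sub>R x"
  have gx: "g x x > 0" using pos x by blast
  have n: "n \<in> V" using x by (simp add: n_def mem_simps)
  have "g n n = 1" using gx x by (simp add: n_def g_scale g_scale_right mem_simps)
  moreover have "S n y = m * g n y" if y: "y \<in> V" for y
  proof -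
    have "S n y = 1 / sqrt (g x x) * S x y"
      using bilinear_on_left[OF S y] x unfolding n_def functional_on_def by blast
    then show ?thesis using null[OF y] x y by (simp add: n_def g_scale P_def)
  qed
  ultimately show ?thesis using n by auto
qed

text \<open>
  Induction on the dimension: split off an extremal vector and continue on its orthogonal
  complement. Stating the result for a form rather than an operator lets the induction run over all
  subspaces \<open>W\<close>, where an operator would first have to be compressed to \<open>W\<close>.
\<close>

lemma diagonalising_onb:
  assumes S: "bilinear_on V S" and S_sym: "\<And>x y. x \<in> V \<Longrightarrow> y \<in> V \<Longrightarrow> S x y = S y x"
    and W: "subspace W" "W \<subseteq> V"
  shows "\<exists>E. orthonormal_basis g E W \<and> (\<forall>e\<in>E. \<forall>f\<in>E. e \<noteq> f \<longrightarrow> S e f = 0)"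
  using W
proof (induction "dim W" arbitrary: W rule: less_induct)
  case less
  show ?case
  proof (cases "W = {0}")
    case True
    then show ?thesis by (intro exI[of _ "{}"]) (auto simp: orthonormal_basis_def)
  next
    case False
    interpret W: euclidean_form W g by (rule subspace_form[OF less.prems])
    have S_symW: "\<And>x y. x \<in> W \<Longrightarrow> y \<in> W \<Longrightarrow> S x y = S y x" using S_sym less.prems(2) by blast
    obtain x where x: "x \<in> W" "g x x = 1" "\<And>y. y \<in> W \<Longrightarrow> g x y = 0 \<Longrightarrow> S x y = 0"
      using W.rayleigh_extremal[OF bilinear_on_subset[OF S less.prems(2)] S_symW False] by blast
    define U where "U = {y \<in> W. \<forall>e\<in>span {x}. g y e = 0}"
    have spx: "orthonormal_basis g {x} (span {x})" "span {x} \<subseteq> W"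
      using x(1,2) W.sub span_minimal[of "{x}" W] by (auto simp: orthonormal_basis_def)
    have U: "subspace U" "U \<subseteq> W"
      unfolding U_def by (intro W.subspace_perp spx(2)) auto
    have split: "orthonormal_basis g ({x} \<union> F) W" "{x} \<inter> F = {}"
      if "orthonormal_basis g F U" for F
      using W.onb_Un_perp[OF spx] that unfolding U_def by blast+
    have "dim U < dim W"
    proof -
      obtain F where F: "orthonormal_basis g F U" using W.onb_exists[OF U] by blast
      have "dim U = card F"
        by (rule W.dim_eq_card_onb[OF F U(2)])
      moreover have "dim W = card ({x} \<union> F)"
        by (rule W.dim_eq_card_onb[OF split(1)[OF F] order_refl])
      ultimately show ?thesis
        using split(2)[OF F] F by (auto simp: orthonormal_basis_def)
    qed
    then obtain F where F: "orthonormal_basis g F U" "\<And>e f. e \<in> F \<Longrightarrow> f \<in> F \<Longrightarrow> e \<noteq> f \<Longrightarrow> S e f = 0"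
      using less.hyps[of U] U less.prems(2) by blast
    have FU: "F \<subseteq> U" using W.onb_subset[OF F(1) U(2)] F(1) span_superset[of F]
      by (auto simp: orthonormal_basis_def)
    have "S x f = 0" "S f x = 0" if "f \<in> F" for f
    proof -
      have f: "f \<in> W" "g f x = 0" using that FU span_superset[of "{x}"] by (auto simp: U_def)
      then show "S x f = 0" using x(3)[OF f(1)] W.sym[OF f(1) x(1)] by simp
      then show "S f x = 0" using S_symW[OF f(1) x(1)] by simp
    qed
    then show ?thesis
      using split(1)[OF F(1)] F(2) by (intro exI[of _ "{x} \<union> F"]) auto
  qed
qed

end

section \<open>The higher order Jacobi operators of a Riemannian model\<close>

locale riemannian_model =
  fixes M :: "'a::real_vector model"
  assumes zero_model: "zero_model M" and riemannian: "riemannian M"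

sublocale riemannian_model \<subseteq> euclidean_form "m_space M" "m_inner M"
proof
  have ip: "inner_product_on (m_space M) (m_inner M)"
    using zero_model by (simp add: zero_model_def)
  show sym: "m_inner M x y = m_inner M y x" if "x \<in> m_space M" "y \<in> m_space M" for x y
    using ip that by (simp add: inner_product_on_def)
  have left: "functional_on (m_space M) (\<lambda>x. m_inner M x y)" if "y \<in> m_space M" for y
    using ip that by (simp add: inner_product_on_def)
  show sub: "subspace (m_space M)" using zero_model by (simp add: zero_model_def)
  have "functional_on (m_space M) (m_inner M x)" if x: "x \<in> m_space M" for x
    using left[OF x] sym[OF x] subspace_add[OF sub] subspace_scale[OF sub]
    unfolding functional_on_def by simp
  then show "bilinear_on (m_space M) (m_inner M)" using left by (simp add: bilinear_on_def)
qed (use zero_model riemannian in \<open>auto simp: zero_model_def riemannian_def\<close>)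

context riemannian_model
begin

abbreviation V where "V \<equiv> m_space M"
abbreviation g where "g \<equiv> m_inner M"
abbreviation A where "A \<equiv> m_tensor M"

lemma A_functional:
  assumes "x \<in> V" "y \<in> V" "z \<in> V"
  shows "functional_on V (\<lambda>w. A w x y z)" "functional_on V (\<lambda>w. A x w y z)"
    "functional_on V (\<lambda>w. A x y w z)" "functional_on V (A x y z)"
  using zero_model assms
  by (simp_all add: zero_model_def curvature_tensor_on_def multilinear4_on_def)

lemma A_bilinear: "x \<in> V \<Longrightarrow> y \<in> V \<Longrightarrow> bilinear_on V (\<lambda>u v. A x u v y)"
  using A_functional by (simp add: bilinear_on_def)

lemma
  assumes "x \<in> V" "y \<in> V" "u \<in> V" "v \<in> V"
  shows A_pair: "A x y u v = A u v x y"
    and A_anti12: "A x y u v = - A y x u v"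
    and A_bianchi: "A x y u v + A y u x v + A u x y v = 0"
  using zero_model assms unfolding zero_model_def curvature_tensor_on_def by blast+

lemma A_anti34:
  assumes "x \<in> V" "y \<in> V" "u \<in> V" "v \<in> V"
  shows "A x y u v = - A x y v u"
  using A_pair[OF assms] A_anti12[of u v x y] A_pair[of v u x y] assms by simp

lemma A_reverse:
  assumes "x \<in> V" "y \<in> V" "u \<in> V" "v \<in> V"
  shows "A x u v y = A y v u x"
  using A_pair[of x u v y] A_anti12[of v y x u] A_anti34[of y v x u] assms by simp

lemma
  assumes "x \<in> V" "y \<in> V" "z \<in> V"
  shows curvature_op_mem: "curvature_op M x y z \<in> V"
    and g_curvature_op: "w \<in> V \<Longrightarrow> g (curvature_op M x y z) w = A x y z w"
  using theI'[OF riesz[OF A_functional(4)[OF assms]]] unfolding curvature_op_def by blast+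

lemma jacobi2_mem: "u \<in> V \<Longrightarrow> v \<in> V \<Longrightarrow> x \<in> V \<Longrightarrow> jacobi2 M u v x \<in> V"
  by (simp add: jacobi2_def curvature_op_mem mem_simps)

lemma g_jacobi2:
  "u \<in> V \<Longrightarrow> v \<in> V \<Longrightarrow> x \<in> V \<Longrightarrow> y \<in> V \<Longrightarrow> g (jacobi2 M u v x) y = (A x u v y + A x v u y) / 2"
  by (simp add: jacobi2_def curvature_op_mem mem_simps g_scale g_add g_curvature_op)

text \<open>
  For fixed \<open>x\<close> and \<open>y\<close> the polarised Jacobi operator is a bilinear form \<open>S u v\<close> whose diagonal is
  \<open>A x e e y\<close>, and the higher order Jacobi operator is its trace over \<open>W\<close>.
\<close>

lemma
  assumes W: "subspace W" "W \<subseteq> V" and x: "x \<in> V"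
  shows higher_jacobi_mem: "higher_jacobi M W x \<in> V"
    and g_higher_jacobi: "\<And>E y. orthonormal_basis g E W \<Longrightarrow> y \<in> V \<Longrightarrow>
      g (higher_jacobi M W x) y = (\<Sum>e\<in>E. A x e e y)"
proof -
  interpret W: euclidean_form W g by (rule subspace_form[OF W])
  define B where "B = (SOME B. is_basis_of B W)"
  obtain F where F: "orthonormal_basis g F W" using onb_exists[OF W] by blast
  have "is_basis_of F W"
    using F onb_independent[OF F W(2)] by (simp add: is_basis_of_def orthonormal_basis_def)
  then have B: "is_basis_of B W" unfolding B_def by (rule someI)
  then have BV: "B \<subseteq> V" using W(2) span_superset[of B] by (auto simp: is_basis_of_def)
  have J: "higher_jacobi M W x
      = (\<Sum>u\<in>B. \<Sum>v\<in>B. gram_inverse g B u v *\<^sub>R jacobi2 M u v x)"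
    by (simp add: higher_jacobi_def jacobi_basis_def B_def)
  have mem: "jacobi2 M u v x \<in> V" if "u \<in> B" "v \<in> B" for u v
    using that BV x by (intro jacobi2_mem) auto
  then show "higher_jacobi M W x \<in> V" unfolding J by (simp add: mem_simps)
  fix E y assume E: "orthonormal_basis g E W" and y: "y \<in> V"
  define S where "S u v = (A x u v y + A x v u y) / 2" for u v
  have "bilinear_on V S"
    using A_bilinear[OF x y] unfolding bilinear_on_def functional_on_def S_def
    by (auto simp: field_simps)
  then have S: "bilinear_on W S" using W(2) by (rule bilinear_on_subset)
  have "g (higher_jacobi M W x) y
      = (\<Sum>u\<in>B. \<Sum>v\<in>B. g (gram_inverse g B u v *\<^sub>R jacobi2 M u v x) y)"
    unfolding J using mem y by (simp add: g_sum mem_simps)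
  also have "\<dots> = (\<Sum>u\<in>B. \<Sum>v\<in>B. gram_inverse g B u v * S u v)"
    using BV x y by (intro sum.cong refl) (simp add: subset_iff g_scale jacobi2_mem g_jacobi2 S_def)
  also have "\<dots> = (\<Sum>e\<in>E. S e e)" by (rule W.trace_gram_inverse[OF B E S])
  finally show "g (higher_jacobi M W x) y = (\<Sum>e\<in>E. A x e e y)" by (simp add: S_def)
qed

lemma higher_jacobi_lincomb:
  assumes W: "subspace W" "W \<subseteq> V" and v: "\<And>i. i \<in> I \<Longrightarrow> v i \<in> V"
  shows "higher_jacobi M W (\<Sum>i\<in>I. c i *\<^sub>R v i) = (\<Sum>i\<in>I. c i *\<^sub>R higher_jacobi M W (v i))"
proof (rule eq_by_inner)
  obtain E where E: "orthonormal_basis g E W" using onb_exists[OF W] by blast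
  have EV: "E \<subseteq> V" using onb_subset[OF E W(2)] .
  have sum_mem: "(\<Sum>i\<in>I. c i *\<^sub>R v i) \<in> V" using v by (intro mem_simps)
  then show "higher_jacobi M W (\<Sum>i\<in>I. c i *\<^sub>R v i) \<in> V" by (rule higher_jacobi_mem[OF W])
  show "(\<Sum>i\<in>I. c i *\<^sub>R higher_jacobi M W (v i)) \<in> V"
    using v by (intro mem_simps higher_jacobi_mem[OF W])
  fix y assume y: "y \<in> V"
  have "g (higher_jacobi M W (\<Sum>i\<in>I. c i *\<^sub>R v i)) y = (\<Sum>e\<in>E. A (\<Sum>i\<in>I. c i *\<^sub>R v i) e e y)"
    by (rule g_higher_jacobi[OF W sum_mem E y])
  also have "\<dots> = (\<Sum>e\<in>E. \<Sum>i\<in>I. c i * A (v i) e e y)"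
    using EV y v by (intro sum.cong refl functional_on_lincomb[OF sub A_functional(1)]) auto
  also have "\<dots> = (\<Sum>i\<in>I. \<Sum>e\<in>E. c i * A (v i) e e y)" by (rule sum.swap)
  also have "\<dots> = (\<Sum>i\<in>I. c i * g (higher_jacobi M W (v i)) y)"
    using v by (intro sum.cong refl) (simp add: g_higher_jacobi[OF W _ E y] sum_distrib_left)
  also have "\<dots> = g (\<Sum>i\<in>I. c i *\<^sub>R higher_jacobi M W (v i)) y"
    using v y by (intro g_lincomb[symmetric] higher_jacobi_mem[OF W])
  finally show "g (higher_jacobi M W (\<Sum>i\<in>I. c i *\<^sub>R v i)) y
      = g (\<Sum>i\<in>I. c i *\<^sub>R higher_jacobi M W (v i)) y" .
qed

lemma higher_jacobi_scale:
  "subspace W \<Longrightarrow> W \<subseteq> V \<Longrightarrow> x \<in> V \<Longrightarrow> higher_jacobi M W (c *\<^sub>R x) = c *\<^sub>R higher_jacobi M W x"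
  using higher_jacobi_lincomb[of W "{()}" "\<lambda>_. x" "\<lambda>_. c"] by simp

lemma higher_jacobi_sum:
  "subspace W \<Longrightarrow> W \<subseteq> V \<Longrightarrow> (\<And>i. i \<in> I \<Longrightarrow> v i \<in> V) \<Longrightarrow>
    higher_jacobi M W (\<Sum>i\<in>I. v i) = (\<Sum>i\<in>I. higher_jacobi M W (v i))"
  using higher_jacobi_lincomb[of W I v "\<lambda>_. 1"] by simp

lemma higher_jacobi_diff:
  assumes "subspace W" "W \<subseteq> V" "x \<in> V" "y \<in> V"
  shows "higher_jacobi M W (x - y) = higher_jacobi M W x - higher_jacobi M W y"
  using higher_jacobi_lincomb[OF assms(1,2), of "{True, False}" "\<lambda>b. if b then x else y"
      "\<lambda>b. if b then 1 else -1"] assms by (simp split: if_splits)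

lemma higher_jacobi_sym:
  assumes W: "subspace W" "W \<subseteq> V" and xy: "x \<in> V" "y \<in> V"
  shows "g (higher_jacobi M W x) y = g (higher_jacobi M W y) x"
proof -
  obtain E where E: "orthonormal_basis g E W" using onb_exists[OF W] by blast
  have EV: "E \<subseteq> V" using onb_subset[OF E W(2)] .
  have "(\<Sum>e\<in>E. A x e e y) = (\<Sum>e\<in>E. A y e e x)"
    using EV xy by (intro sum.cong refl A_reverse) auto
  then show ?thesis using g_higher_jacobi[OF W _ E] xy by simp
qed

lemma higher_jacobi_perp:
  assumes W: "subspace W" "W \<subseteq> V" and x: "x \<in> V"
  shows "subspace (perp M W)" "perp M W \<subseteq> V"
    "higher_jacobi M (perp M W) x = ricci_op M x - higher_jacobi M W x"
proof -
  show P: "subspace (perp M W)" "perp M W \<subseteq> V"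
    using subspace_perp[OF W(2)] by (auto simp: perp_def)
  obtain E where E: "orthonormal_basis g E W" using onb_exists[OF W] by blast
  obtain F where F: "orthonormal_basis g F (perp M W)" using onb_exists[OF P] by blast
  have EF: "orthonormal_basis g (E \<union> F) V" "E \<inter> F = {}" "finite E" "finite F"
    using onb_Un_perp[OF E W(2) F[unfolded perp_def]] E F unfolding orthonormal_basis_def
    by blast+
  have mem: "higher_jacobi M W x \<in> V" "higher_jacobi M (perp M W) x \<in> V" "ricci_op M x \<in> V"
    unfolding ricci_op_def
    using higher_jacobi_mem[OF W x] higher_jacobi_mem[OF P x] higher_jacobi_mem[OF sub _ x] by simp_all
  show "higher_jacobi M (perp M W) x = ricci_op M x - higher_jacobi M W x"
  proof (rule eq_by_inner)
    fix y assume y: "y \<in> V"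
    have "g (ricci_op M x) y = (\<Sum>e\<in>E \<union> F. A x e e y)"
      unfolding ricci_op_def using sub x EF y by (intro g_higher_jacobi) auto
    also have "\<dots> = g (higher_jacobi M W x) y + g (higher_jacobi M (perp M W) x) y"
      using EF by (simp add: sum.union_disjoint g_higher_jacobi[OF W x E y] g_higher_jacobi[OF P x F y])
    finally show "g (higher_jacobi M (perp M W) x) y = g (ricci_op M x - higher_jacobi M W x) y"
      using mem y by (simp add: g_diff)
  qed (use mem in \<open>simp_all add: mem_simps\<close>)
qed

text \<open>
  The operator of the complement is \<open>\<rho> - J W\<close>, and \<open>J W\<close> commutes with itself. Positive definiteness
  makes every subspace non-degenerate.
\<close>

lemma puffini_videv_iff_commutes_ricci:
  "puffini_videv M \<longleftrightarrow> (\<forall>W. subspace W \<and> W \<subseteq> V \<longrightarrow> (\<forall>x\<in>V.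
     higher_jacobi M W (ricci_op M x) = ricci_op M (higher_jacobi M W x)))"
proof -
  have nondeg: "nondegenerate_subspace M W \<longleftrightarrow> subspace W \<and> W \<subseteq> V" for W
    using g_pos_iff by (auto simp: nondegenerate_subspace_def nondegenerate_on_def subset_iff)
  have "higher_jacobi M W (higher_jacobi M (perp M W) x)
        = higher_jacobi M (perp M W) (higher_jacobi M W x) \<longleftrightarrow>
      higher_jacobi M W (ricci_op M x) = ricci_op M (higher_jacobi M W x)"
    if W: "subspace W" "W \<subseteq> V" and x: "x \<in> V" for W x
  proof -
    have mem: "higher_jacobi M W x \<in> V" "ricci_op M x \<in> V"
      unfolding ricci_op_def using higher_jacobi_mem[OF W x] higher_jacobi_mem[OF sub _ x] by simp_all
    show ?thesis
      using higher_jacobi_perp(3)[OF W x] higher_jacobi_perp(3)[OF W mem(1)]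
        higher_jacobi_diff[OF W mem(2,1)] by simp
  qed
  then show ?thesis by (auto simp: puffini_videv_def nondeg)
qed


lemma ricci_mem: "x \<in> V \<Longrightarrow> ricci_op M x \<in> V"
  unfolding ricci_op_def by (rule higher_jacobi_mem[OF sub order_refl])

lemma ricci_sym: "x \<in> V \<Longrightarrow> y \<in> V \<Longrightarrow> g (ricci_op M x) y = g (ricci_op M y) x"
  unfolding ricci_op_def by (rule higher_jacobi_sym[OF sub order_refl])

lemma ricci_lincomb:
  "(\<And>i. i \<in> I \<Longrightarrow> v i \<in> V) \<Longrightarrow> ricci_op M (\<Sum>i\<in>I. c i *\<^sub>R v i) = (\<Sum>i\<in>I. c i *\<^sub>R ricci_op M (v i))"
  unfolding ricci_op_def by (rule higher_jacobi_lincomb[OF sub order_refl])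

lemma ricci_scale: "x \<in> V \<Longrightarrow> ricci_op M (c *\<^sub>R x) = c *\<^sub>R ricci_op M x"
  unfolding ricci_op_def by (rule higher_jacobi_scale[OF sub order_refl])

lemma g_ricci:
  "orthonormal_basis g E V \<Longrightarrow> x \<in> V \<Longrightarrow> y \<in> V \<Longrightarrow> g (ricci_op M x) y = (\<Sum>e\<in>E. A x e e y)"
  unfolding ricci_op_def by (rule g_higher_jacobi[OF sub order_refl])

section \<open>Eigenspaces of the Ricci operator\<close>

definition eigenspace :: "real \<Rightarrow> 'a set" where
  "eigenspace c = {x \<in> V. ricci_op M x = c *\<^sub>R x}"

lemma eigenspace_subset: "eigenspace c \<subseteq> V"
  by (auto simp: eigenspace_def)

lemma subspace_eigenspace: "subspace (eigenspace c)"
proof -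
  have add: "ricci_op M (x + y) = ricci_op M x + ricci_op M y" if "x \<in> V" "y \<in> V" for x y
    using ricci_lincomb[of "{True, False}" "\<lambda>b. if b then x else y" "\<lambda>_. 1"] that
    by (simp split: if_splits)
  have "ricci_op M 0 = 0" using ricci_scale[of 0 0] mem_simps(1) by simp
  then show ?thesis
    unfolding subspace_def eigenspace_def
    by (auto simp: mem_simps add ricci_scale scaleR_right_distrib)
qed

lemma eigenspace_orthogonal:
  assumes x: "x \<in> eigenspace a" and y: "y \<in> eigenspace b" and "a \<noteq> b"
  shows "g x y = 0"
proof -
  have V: "x \<in> V" "y \<in> V" and r: "ricci_op M x = a *\<^sub>R x" "ricci_op M y = b *\<^sub>R y"
    using x y by (auto simp: eigenspace_def)
  have "a * g x y = b * g y x"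
    using ricci_sym[OF V] V unfolding r by (simp add: g_scale)
  then show ?thesis using sym[OF V] \<open>a \<noteq> b\<close> by simp
qed

text \<open>
  On a basis of the whole space that diagonalises the form \<open>\<langle>\<rho> x, y\<rangle>\<close>, the vector \<open>\<rho> e\<close> has no
  component other than that along \<open>e\<close>.
\<close>

lemma ricci_eigenbasis:
  obtains E l where "orthonormal_basis g E V" "\<And>e. e \<in> E \<Longrightarrow> e \<in> eigenspace (l e)"
proof -
  define S where "S x y = g (ricci_op M x) y" for x y
  have S_sym: "S x y = S y x" if "x \<in> V" "y \<in> V" for x y
    unfolding S_def using that by (rule ricci_sym)
  have right: "functional_on V (S x)" if "x \<in> V" for x
    unfolding S_def by (rule bilinear_on_right[OF bil ricci_mem[OF that]])
  have "functional_on V (\<lambda>x. S x y)" if "y \<in> V" for y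
    using right[OF that] S_sym[OF _ that] mem_simps(2,4) unfolding functional_on_def by simp
  then have S: "bilinear_on V S" using right by (simp add: bilinear_on_def)
  obtain E where E: "orthonormal_basis g E V" "\<And>e f. e \<in> E \<Longrightarrow> f \<in> E \<Longrightarrow> e \<noteq> f \<Longrightarrow> S e f = 0"
    using diagonalising_onb[OF S S_sym sub order_refl] by blast
  have EV: "finite E" "E \<subseteq> V" using E(1) onb_subset[OF E(1)] by (auto simp: orthonormal_basis_def)
  have "e \<in> eigenspace (S e e)" if e: "e \<in> E" for e
  proof -
    have eV: "e \<in> V" using e EV by blast
    have "ricci_op M e = S e e *\<^sub>R e"
    proof (rule eq_by_inner)
      fix y assume y: "y \<in> V"
      have "S e y = S e (\<Sum>f\<in>E. g y f *\<^sub>R f)" using onb_expand[OF E(1) y] by simp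
      also have "\<dots> = (\<Sum>f\<in>E. g y f * S e f)"
        using EV by (intro functional_on_lincomb[OF sub right[OF eV]]) auto
      also have "\<dots> = (\<Sum>f\<in>E. if f = e then g y e * S e e else 0)"
        using E(2)[OF e] by (intro sum.cong) auto
      also have "\<dots> = S e e * g e y" using EV e sym[OF eV y] by simp
      finally show "g (ricci_op M e) y = g (S e e *\<^sub>R e) y"
        using eV y by (simp add: S_def g_scale)
    qed (use eV in \<open>simp_all add: ricci_mem mem_simps\<close>)
    then show ?thesis using eV by (simp add: eigenspace_def)
  qed
  then show ?thesis by (rule that[OF E(1)])
qed

section \<open>Curvature vanishes on mixed eigenvectors\<close>

lemma curvature_polarise:
  assumes null: "\<And>w. w \<in> V \<Longrightarrow> A x w w y = 0" and V: "x \<in> V" "y \<in> V" "u \<in> V" "v \<in> V"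
  shows "A x u v y = - A x v u y"
proof -
  have uv: "u + v \<in> V" using V by (simp add: mem_simps)
  have "A x (u + v) (u + v) y = A x u (u + v) y + A x v (u + v) y"
    using A_functional(2)[OF V(1) uv V(2)] V by (simp add: functional_on_def)
  also have "A x u (u + v) y = A x u u y + A x u v y"
    using A_functional(3)[OF V(1,3,2)] V by (simp add: functional_on_def)
  also have "A x v (u + v) y = A x v u y + A x v v y"
    using A_functional(3)[OF V(1,4,2)] V by (simp add: functional_on_def)
  finally show ?thesis using null[OF uv] null[OF V(3)] null[OF V(4)] by simp
qed

text \<open>
  Applied to the line through \<open>v\<close>, the condition says that the Jacobi operator of \<open>v\<close> commutes with
  the Ricci operator, hence preserves its eigenspaces.
\<close>

lemma jacobi_preserves_eigenspaces:
  assumes pv: "puffini_videv M" and x: "x \<in> eigenspace a" and y: "y \<in> eigenspace b"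
    and "a \<noteq> b" and v: "v \<in> V"
  shows "A x v v y = 0"
proof (cases "v = 0")
  case True
  have "x \<in> V" "y \<in> V" using x y by (auto simp: eigenspace_def)
  then show ?thesis
    using True v functional_on_zero[OF sub A_functional(2)[of x v y]] by simp
next
  case False
  have xV: "x \<in> V" and yV: "y \<in> V" and r: "ricci_op M x = a *\<^sub>R x" "ricci_op M y = b *\<^sub>R y"
    using x y by (auto simp: eigenspace_def)
  \<comment> \<open>The line through \<open>v\<close> has the orthonormal basis consisting of \<open>u = s v\<close>.\<close>
  define s where "s = 1 / sqrt (g v v)"
  have gv: "g v v > 0" by (rule pos[OF v False])
  have s: "s \<noteq> 0" "s * s * g v v = 1" using gv by (simp_all add: s_def)
  define u where "u = s *\<^sub>R v"
  have u: "u \<in> V" "g u u = 1"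
    using v s by (simp_all add: u_def mem_simps g_scale g_scale_right mult.assoc)
  define W where "W = span {u}"
  have W: "subspace W" "W \<subseteq> V" using u sub span_minimal[of "{u}" V] by (auto simp: W_def)
  have E: "orthonormal_basis g {u} W" using u by (simp add: orthonormal_basis_def W_def)
  define J where "J = higher_jacobi M W"
  have J: "J x \<in> V" unfolding J_def by (rule higher_jacobi_mem[OF W xV])
  have J_xy: "g (J x) y = A x u u y" unfolding J_def using g_higher_jacobi[OF W xV E yV] by simp
  have "J (ricci_op M x) = ricci_op M (J x)"
    using pv W xV unfolding puffini_videv_iff_commutes_ricci J_def by blast
  then have "g (a *\<^sub>R J x) y = g (b *\<^sub>R y) (J x)"
    using ricci_sym[OF J yV] higher_jacobi_scale[OF W xV] unfolding r J_def by simp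
  then have "a * A x u u y = b * A x u u y"
    using J yV J_xy sym[OF J yV] by (simp add: g_scale)
  then have "A x u u y = 0" using \<open>a \<noteq> b\<close> by simp
  moreover have "A x u u y = s * (s * A x v v y)"
  proof -
    have "A x u u y = s * A x v u y"
      using A_functional(2)[OF xV u(1) yV] v unfolding functional_on_def u_def by blast
    moreover have "A x v u y = s * A x v v y"
      using A_functional(3)[OF xV v yV] v unfolding functional_on_def u_def by blast
    ultimately show ?thesis by simp
  qed
  ultimately show ?thesis using s(1) by simp
qed

text \<open>
  If \<open>x\<close> belongs to an eigenvalue different from those of \<open>y\<close> and \<open>v\<close>, then \<open>A x u v y\<close> changes sign
  under \<open>u \<leftrightarrow> v\<close> by the pair \<open>(x, y)\<close>, and \<open>A x u y v\<close> under \<open>u \<leftrightarrow> y\<close> by the pair \<open>(x, v)\<close>. With these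
  signs all three terms of the Bianchi identity coincide. Otherwise exchange the roles of \<open>x\<close>
  and \<open>y\<close>.
\<close>

lemma curvature_mixed_eigenvectors:
  assumes pv: "puffini_videv M" and x: "x \<in> eigenspace a" and y: "y \<in> eigenspace b"
    and "a \<noteq> b" and v: "v \<in> eigenspace c" and u: "u \<in> V"
  shows "A x u v y = 0"
proof -
  have key: "A x u v y = 0"
    if x: "x \<in> eigenspace a" and y: "y \<in> eigenspace b" and "a \<noteq> b" "c \<noteq> a" for x y a b
  proof -
    have V: "x \<in> V" "y \<in> V" "v \<in> V" using x y v by (auto simp: eigenspace_def)
    have "A x u v y = - A x v u y"
      using curvature_polarise[OF jacobi_preserves_eigenspaces[OF pv x y \<open>a \<noteq> b\<close>]] V u by blast
    moreover have "A x u y v = - A x y u v"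
      using curvature_polarise[OF jacobi_preserves_eigenspaces[OF pv x v]] V u \<open>c \<noteq> a\<close> by blast
    ultimately show ?thesis
      using A_anti34[of x u v y] A_pair[of x y u v] A_bianchi[of x u v y] A_anti12[of v x u y] V u
      by simp
  qed
  show ?thesis
  proof (cases "c = a")
    case False
    then show ?thesis using key[OF x y \<open>a \<noteq> b\<close>] by simp
  next
    case True
    have V: "x \<in> V" "y \<in> V" "v \<in> V" using x y v by (auto simp: eigenspace_def)
    have "A x u v y = - A x v u y"
      using curvature_polarise[OF jacobi_preserves_eigenspaces[OF pv x y \<open>a \<noteq> b\<close>]] V u by blast
    then show ?thesis
      using key[OF y x] A_reverse[of x y v u] V u True \<open>a \<noteq> b\<close> by simp
  qed
qed

text \<open>The eigenvectors span, so the third argument may be arbitrary.\<close>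

lemma curvature_mixed_outer:
  assumes pv: "puffini_videv M" and x: "x \<in> eigenspace a" and y: "y \<in> eigenspace b"
    and "a \<noteq> b" and V: "u \<in> V" "v \<in> V"
  shows "A x u v y = 0"
proof -
  obtain E l where E: "orthonormal_basis g E V" "\<And>e. e \<in> E \<Longrightarrow> e \<in> eigenspace (l e)"
    using ricci_eigenbasis by blast
  have xy: "x \<in> V" "y \<in> V" using x y by (auto simp: eigenspace_def)
  have "A x u v y = A x u (\<Sum>e\<in>E. g v e *\<^sub>R e) y" using onb_expand[OF E(1) V(2)] by simp
  also have "\<dots> = (\<Sum>e\<in>E. g v e * A x u e y)"
    using onb_subset[OF E(1)] V xy by (intro functional_on_lincomb[OF sub A_functional(3)]) auto
  also have "\<dots> = 0"
    using curvature_mixed_eigenvectors[OF pv x y \<open>a \<noteq> b\<close> E(2) V(1)] by (intro sum.neutral) simp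
  finally show ?thesis .
qed

text \<open>
  By the symmetries of \<open>A\<close>, different eigenvalues at the two inner or at the two outer positions, or
  at positions one and three or two and four, are covered by the preceding lemma. For the first two
  positions the Bianchi identity reduces the claim to those cases, and pair symmetry transfers it to
  the last two.
\<close>

lemma curvature_mixed:
  assumes pv: "puffini_videv M"
    and x: "x1 \<in> eigenspace a1" "x2 \<in> eigenspace a2" "x3 \<in> eigenspace a3" "x4 \<in> eigenspace a4"
    and ne: "\<not> (a1 = a2 \<and> a2 = a3 \<and> a3 = a4)"
  shows "A x1 x2 x3 x4 = 0"
proof -
  have V: "x1 \<in> V" "x2 \<in> V" "x3 \<in> V" "x4 \<in> V" using x by (auto simp: eigenspace_def)
  note outer = curvature_mixed_outer[OF pv]
  have first_pair: "A x y u v = 0"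
    if "x \<in> eigenspace a" "y \<in> eigenspace b" "a \<noteq> b" "u \<in> V" "v \<in> V" for x y u v a b
  proof -
    have xy: "x \<in> V" "y \<in> V" using that by (auto simp: eigenspace_def)
    have "A y u x v = 0"
      using outer[OF that(2,1)] A_anti34[of y u x v] xy that by simp
    moreover have "A u x y v = 0"
      using outer[OF that(1,2,3)] A_anti12[of u x y v] A_anti34[of x u y v] xy that by simp
    ultimately show ?thesis using A_bianchi[of x y u v] xy that by simp
  qed
  consider "a1 \<noteq> a4" | "a2 \<noteq> a3" | "a1 \<noteq> a2" | "a3 \<noteq> a4" using ne by blast
  then show ?thesis
  proof cases
    case 1
    then show ?thesis using outer[OF x(1,4)] V by blast
  next
    case 2
    then have "A x2 x1 x4 x3 = 0" using outer[OF x(2,3)] V by blast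
    then show ?thesis using A_anti12[of x1 x2 x3 x4] A_anti34[of x2 x1 x3 x4] V by simp
  next
    case 3
    then show ?thesis using first_pair[OF x(1,2)] V by blast
  next
    case 4
    then have "A x3 x4 x1 x2 = 0" using first_pair[OF x(3,4)] V by blast
    then show ?thesis using A_pair[of x1 x2 x3 x4] V by simp
  qed
qed

section \<open>Orthogonal direct sums\<close>

lemma
  assumes ds: "is_direct_sum M k N"
  shows direct_sum_subspace: "i < k \<Longrightarrow> subspace (m_space (N i))" "i < k \<Longrightarrow> m_space (N i) \<subseteq> V"
    and direct_sum_unique: "x \<in> V \<Longrightarrow> \<exists>!f. f \<in> (\<Pi>\<^sub>E i\<in>{..<k}. m_space (N i)) \<and> x = (\<Sum>i<k. f i)"
    and direct_sum_orthogonal: "i < k \<Longrightarrow> j < k \<Longrightarrow> i \<noteq> j \<Longrightarrow>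
      x \<in> m_space (N i) \<Longrightarrow> y \<in> m_space (N j) \<Longrightarrow> g x y = 0"
    and direct_sum_inner: "i < k \<Longrightarrow> x \<in> m_space (N i) \<Longrightarrow> y \<in> m_space (N i) \<Longrightarrow>
      m_inner (N i) x y = g x y"
    and direct_sum_tensor: "i < k \<Longrightarrow> x1 \<in> m_space (N i) \<Longrightarrow> x2 \<in> m_space (N i) \<Longrightarrow>
      x3 \<in> m_space (N i) \<Longrightarrow> x4 \<in> m_space (N i) \<Longrightarrow> m_tensor (N i) x1 x2 x3 x4 = A x1 x2 x3 x4"
    and direct_sum_mixed: "i1 < k \<Longrightarrow> i2 < k \<Longrightarrow> i3 < k \<Longrightarrow> i4 < k \<Longrightarrow>
      \<not> (i1 = i2 \<and> i2 = i3 \<and> i3 = i4) \<Longrightarrow> x1 \<in> m_space (N i1) \<Longrightarrow> x2 \<in> m_space (N i2) \<Longrightarrow>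
      x3 \<in> m_space (N i3) \<Longrightarrow> x4 \<in> m_space (N i4) \<Longrightarrow> A x1 x2 x3 x4 = 0"
proof -
  note ds = ds[unfolded is_direct_sum_def]
  note c1 = ds[THEN conjunct1] and ds = ds[THEN conjunct2]
  note c2 = ds[THEN conjunct1] and ds = ds[THEN conjunct2]
  note c3 = ds[THEN conjunct1] and ds = ds[THEN conjunct2]
  note c4 = ds[THEN conjunct1] and ds = ds[THEN conjunct2]
  note c5 = ds[THEN conjunct1] and c6 = ds[THEN conjunct2]
  show "i < k \<Longrightarrow> subspace (m_space (N i))" "i < k \<Longrightarrow> m_space (N i) \<subseteq> V"
    using c1 by simp_all
  show "x \<in> V \<Longrightarrow> \<exists>!f. f \<in> (\<Pi>\<^sub>E i\<in>{..<k}. m_space (N i)) \<and> x = (\<Sum>i<k. f i)"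
    by (rule bspec[OF c2])
  show "i < k \<Longrightarrow> j < k \<Longrightarrow> i \<noteq> j \<Longrightarrow> x \<in> m_space (N i) \<Longrightarrow> y \<in> m_space (N j) \<Longrightarrow> g x y = 0"
    using c3 by simp
  show "i < k \<Longrightarrow> x \<in> m_space (N i) \<Longrightarrow> y \<in> m_space (N i) \<Longrightarrow> m_inner (N i) x y = g x y"
    using c4 by simp
  show "i < k \<Longrightarrow> x1 \<in> m_space (N i) \<Longrightarrow> x2 \<in> m_space (N i) \<Longrightarrow>
      x3 \<in> m_space (N i) \<Longrightarrow> x4 \<in> m_space (N i) \<Longrightarrow> m_tensor (N i) x1 x2 x3 x4 = A x1 x2 x3 x4"
    using c5 by simp
  show "i1 < k \<Longrightarrow> i2 < k \<Longrightarrow> i3 < k \<Longrightarrow> i4 < k \<Longrightarrow>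
      \<not> (i1 = i2 \<and> i2 = i3 \<and> i3 = i4) \<Longrightarrow> x1 \<in> m_space (N i1) \<Longrightarrow> x2 \<in> m_space (N i2) \<Longrightarrow>
      x3 \<in> m_space (N i3) \<Longrightarrow> x4 \<in> m_space (N i4) \<Longrightarrow> A x1 x2 x3 x4 = 0"
    by (rule c6[rule_format])
qed

lemma direct_sum_expand:
  assumes "is_direct_sum M k N" "x \<in> V"
  obtains f where "\<And>i. i < k \<Longrightarrow> f i \<in> m_space (N i)" "x = (\<Sum>i<k. f i)"
proof -
  obtain f where f: "f \<in> (\<Pi>\<^sub>E i\<in>{..<k}. m_space (N i))" "x = (\<Sum>i<k. f i)"
    using ex1_implies_ex[OF direct_sum_unique[OF assms]] by (elim exE conjE)
  show ?thesis using f(1) by (intro that[OF _ f(2)]) auto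
qed

lemma direct_sum_component:
  assumes ds: "is_direct_sum M k N" and f: "\<And>i. i < k \<Longrightarrow> f i \<in> m_space (N i)"
    and j: "j < k" "y \<in> m_space (N j)"
  shows "g (\<Sum>i<k. f i) y = g (f j) y"
proof -
  have "g (\<Sum>i<k. f i) y = (\<Sum>i<k. g (f i) y)"
    using f direct_sum_subspace(2)[OF ds] j by (intro g_sum) auto
  also have "\<dots> = (\<Sum>i<k. if i = j then g (f j) y else 0)"
    using direct_sum_orthogonal[OF ds _ j(1) _ f j(2)] by (intro sum.cong) auto
  finally show ?thesis using j by simp
qed

lemma direct_sum_curvature_split:
  assumes ds: "is_direct_sum M k N" and V: "x \<in> V" "y \<in> V"
    and f: "\<And>i. i < k \<Longrightarrow> f i \<in> m_space (N i)" and h: "\<And>i. i < k \<Longrightarrow> h i \<in> m_space (N i)"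
  shows "A x (\<Sum>i<k. f i) (\<Sum>i<k. h i) y = (\<Sum>i<k. \<Sum>j<k. A x (f i) (h j) y)"
proof -
  have "f i \<in> V" "h i \<in> V" if "i < k" for i
    using direct_sum_subspace(2)[OF ds that] f[OF that] h[OF that] by auto
  then show ?thesis
    using bilinear_on_lincomb[OF sub A_bilinear[OF V], of "{..<k}" f "{..<k}" h "\<lambda>_. 1" "\<lambda>_. 1"]
    by simp
qed

text \<open>
  Whatever summands the components of \<open>w\<close> lie in, each term of the expansion has \<open>x\<close> and \<open>y\<close> from
  different ones.
\<close>

lemma direct_sum_curvature_mixed:
  assumes ds: "is_direct_sum M k N" and ij: "i < k" "j < k" "i \<noteq> j"
    and x: "x \<in> m_space (N i)" and y: "y \<in> m_space (N j)" and w: "w \<in> V"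
  shows "A x w w y = 0"
proof -
  obtain f where f: "\<And>i. i < k \<Longrightarrow> f i \<in> m_space (N i)" "w = (\<Sum>i<k. f i)"
    using direct_sum_expand[OF ds w] by blast
  have "x \<in> V" "y \<in> V" using direct_sum_subspace(2)[OF ds] ij x y by auto
  then have "A x w w y = (\<Sum>a<k. \<Sum>b<k. A x (f a) (f b) y)"
    unfolding f(2) using direct_sum_curvature_split[OF ds _ _ f(1) f(1)] by blast
  also have "\<dots> = 0"
  proof (intro sum.neutral ballI)
    fix a b assume "a \<in> {..<k}" "b \<in> {..<k}"
    moreover have "\<not> (i = a \<and> a = b \<and> b = j)" using ij by blast
    ultimately show "A x (f a) (f b) y = 0"
      using direct_sum_mixed[OF ds, of i a b j] ij x y f(1) by simp
  qed
  finally show ?thesis .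
qed

text \<open>A vector orthogonal to the summand has zero component in it, so only mixed terms remain.\<close>

lemma direct_sum_curvature_perp:
  assumes ds: "is_direct_sum M k N" and i: "i < k"
    and x: "x \<in> m_space (N i)" and y: "y \<in> m_space (N i)"
    and w: "w \<in> V" "\<And>z. z \<in> m_space (N i) \<Longrightarrow> g w z = 0"
  shows "A x w w y = 0"
proof -
  obtain f where f: "\<And>i. i < k \<Longrightarrow> f i \<in> m_space (N i)" "w = (\<Sum>i<k. f i)"
    using direct_sum_expand[OF ds w(1)] by blast
  have V: "x \<in> V" "y \<in> V" and fV: "\<And>i. i < k \<Longrightarrow> f i \<in> V"
    using direct_sum_subspace(2)[OF ds] i x y f(1) by auto
  have "g (f i) (f i) = 0"
    using direct_sum_component[OF ds f(1) i f(1)[OF i]] w(2)[OF f(1)[OF i]] f(2) by simp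
  then have fi: "f i = 0" using g_pos_iff fV[OF i] by blast
  have "A x w w y = (\<Sum>a<k. \<Sum>b<k. A x (f a) (f b) y)"
    unfolding f(2) using direct_sum_curvature_split[OF ds V f(1) f(1)] by blast
  also have "\<dots> = 0"
  proof (intro sum.neutral ballI)
    fix a b assume ab: "a \<in> {..<k}" "b \<in> {..<k}"
    show "A x (f a) (f b) y = 0"
    proof (cases "a = i \<and> b = i")
      case True
      then show ?thesis
        using fi functional_on_zero[OF sub A_functional(2)[OF V(1) fV[OF i] V(2)]] by simp
    next
      case False
      then have "\<not> (i = a \<and> a = b \<and> b = i)" by blast
      then show ?thesis using direct_sum_mixed[OF ds, of i a b i] i x y f(1) ab by simp
    qed
  qed
  finally show ?thesis .
qed

lemma direct_sum_riemannian_model: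
  assumes ds: "is_direct_sum M k N" and i: "i < k" and zm: "zero_model (N i)"
  shows "riemannian_model (N i)"
proof
  have "m_inner (N i) x x = g x x" if "x \<in> m_space (N i)" for x
    using direct_sum_inner[OF ds i that that] .
  then show "riemannian (N i)"
    using direct_sum_subspace(2)[OF ds i] pos by (auto simp: riemannian_def)
qed (rule zm)

text \<open>
  Complete an orthonormal basis of the summand by one of its orthogonal complement: the
  complement contributes nothing to the trace.
\<close>

lemma direct_sum_ricci:
  assumes ds: "is_direct_sum M k N" and i: "i < k" and zm: "zero_model (N i)"
    and x: "x \<in> m_space (N i)"
  shows "ricci_op M x = ricci_op (N i) x"
proof -
  interpret N: riemannian_model "N i" by (rule direct_sum_riemannian_model[OF ds i zm])
  note W = direct_sum_subspace[OF ds i]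
  have g_eq: "m_inner (N i) u v = g u v" if "u \<in> m_space (N i)" "v \<in> m_space (N i)" for u v
    by (rule direct_sum_inner[OF ds i that])
  have A_eq: "m_tensor (N i) x1 x2 x3 x4 = A x1 x2 x3 x4"
    if "x1 \<in> m_space (N i)" "x2 \<in> m_space (N i)" "x3 \<in> m_space (N i)" "x4 \<in> m_space (N i)"
    for x1 x2 x3 x4
    by (rule direct_sum_tensor[OF ds i that])
  define P where "P = {y \<in> V. \<forall>e\<in>m_space (N i). g y e = 0}"
  have P: "subspace P" "P \<subseteq> V" unfolding P_def by (intro subspace_perp W(2)) auto
  obtain E where E: "orthonormal_basis g E (m_space (N i))" using onb_exists[OF W] by blast
  obtain F where F: "orthonormal_basis g F P" using onb_exists[OF P] by blast
  note EF = onb_Un_perp[OF E W(2) F[unfolded P_def]]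
  have fin: "finite E" "finite F" using E F by (auto simp: orthonormal_basis_def)
  have EN: "E \<subseteq> m_space (N i)" and FP: "F \<subseteq> P"
    using E F span_superset[of E] span_superset[of F] by (auto simp: orthonormal_basis_def)
  have E': "orthonormal_basis (m_inner (N i)) E (m_space (N i))"
    using E EN g_eq by (auto simp: orthonormal_basis_def subset_iff)
  have xV: "x \<in> V" and rx: "ricci_op (N i) x \<in> m_space (N i)" "ricci_op (N i) x \<in> V"
    using x W(2) N.ricci_mem[OF x] by auto
  show ?thesis
  proof (rule eq_by_inner)
    have on_summand: "g (ricci_op M x) y = g (ricci_op (N i) x) y"
      if j: "j < k" and y: "y \<in> m_space (N j)" for j y
    proof (cases "j = i")
      case True
      have yV: "y \<in> V" and yN: "y \<in> m_space (N i)" using y True W(2) by auto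
      have "g (ricci_op M x) y = (\<Sum>e\<in>E. A x e e y) + (\<Sum>e\<in>F. A x e e y)"
        using g_ricci[OF EF(1) xV yV] fin EF(2) by (simp add: sum.union_disjoint)
      also have "(\<Sum>e\<in>F. A x e e y) = 0"
        using FP by (intro sum.neutral ballI direct_sum_curvature_perp[OF ds i x yN])
          (auto simp: P_def)
      also have "(\<Sum>e\<in>E. A x e e y) = (\<Sum>e\<in>E. m_tensor (N i) x e e y)"
        using EN x yN by (intro sum.cong refl A_eq[symmetric]) auto
      also have "\<dots> = g (ricci_op (N i) x) y"
        using N.g_ricci[OF E' x yN] g_eq[OF rx(1) yN] by simp
      finally show ?thesis by simp
    next
      case False
      have yV: "y \<in> V" using y direct_sum_subspace(2)[OF ds j] by auto
      obtain G where G: "orthonormal_basis g G V" using onb_exists[OF sub] by blast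
      have "(\<Sum>e\<in>G. A x e e y) = 0"
        using onb_subset[OF G] False
        by (intro sum.neutral ballI direct_sum_curvature_mixed[OF ds i j _ x y]) auto
      then show ?thesis
        using g_ricci[OF G xV yV] direct_sum_orthogonal[OF ds i j _ rx(1) y] False by simp
    qed
    fix y assume "y \<in> V"
    then obtain f where f: "\<And>i. i < k \<Longrightarrow> f i \<in> m_space (N i)" "y = (\<Sum>i<k. f i)"
      using direct_sum_expand[OF ds] by blast
    have fV: "f i \<in> V" if "i < k" for i using f(1)[OF that] direct_sum_subspace(2)[OF ds that] by auto
    have "g z y = (\<Sum>i<k. g z (f i))" if "z \<in> V" for z
      unfolding f(2) using fV by (intro functional_on_sum[OF sub bilinear_on_right[OF bil that]]) auto
    then show "g (ricci_op M x) y = g (ricci_op (N i) x) y"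
      using on_summand f(1) rx(2) ricci_mem[OF xV] by simp
  qed (use rx xV ricci_mem in auto)
qed

section \<open>Puffini--Videv models and sums of Einstein models\<close>

text \<open>
  Each \<open>J W\<close> preserves the summands, and the Ricci operator acts on each summand as a scalar.
\<close>

lemma direct_sum_einstein_imp_puffini_videv:
  assumes ds: "is_direct_sum M k N" and N: "\<And>i. i < k \<Longrightarrow> zero_model (N i) \<and> einstein (N i)"
  shows "puffini_videv M"
  unfolding puffini_videv_iff_commutes_ricci
proof (intro allI impI ballI)
  fix W x assume "subspace W \<and> W \<subseteq> V" and x: "x \<in> V"
  then have W: "subspace W" "W \<subseteq> V" by auto
  define J where "J = higher_jacobi M W"
  have "\<exists>c. \<forall>x\<in>m_space (N i). ricci_op M x = c *\<^sub>R x" if "i < k" for i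
    using N[OF that] direct_sum_ricci[OF ds that] by (auto simp: einstein_def)
  then obtain c where c: "\<And>i x. i < k \<Longrightarrow> x \<in> m_space (N i) \<Longrightarrow> ricci_op M x = c i *\<^sub>R x"
    by metis
  obtain E where E: "orthonormal_basis g E W" using onb_exists[OF W] by blast
  have EV: "E \<subseteq> V" by (rule onb_subset[OF E W(2)])
  have J_mem: "J x \<in> V" if "x \<in> V" for x unfolding J_def by (rule higher_jacobi_mem[OF W that])
  have preserves: "J x \<in> m_space (N i)" if i: "i < k" and x: "x \<in> m_space (N i)" for i x
  proof -
    have xV: "x \<in> V" using x direct_sum_subspace(2)[OF ds i] by blast
    obtain f where f: "\<And>i. i < k \<Longrightarrow> f i \<in> m_space (N i)" "J x = (\<Sum>i<k. f i)"
      using direct_sum_expand[OF ds J_mem[OF xV]] by blast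
    have "f j = 0" if j: "j < k" "j \<noteq> i" for j
    proof -
      have fj: "f j \<in> m_space (N j)" "f j \<in> V"
        using f(1)[OF j(1)] direct_sum_subspace(2)[OF ds j(1)] by auto
      have "g (J x) (f j) = (\<Sum>e\<in>E. A x e e (f j))"
        unfolding J_def by (rule g_higher_jacobi[OF W xV E fj(2)])
      also have "\<dots> = 0"
        using EV j(2)
        by (intro sum.neutral ballI direct_sum_curvature_mixed[OF ds i j(1) _ x fj(1)]) auto
      finally have "g (f j) (f j) = 0"
        using direct_sum_component[OF ds f(1) j(1) fj(1)] f(2) by simp
      then show ?thesis using g_pos_iff fj(2) by blast
    qed
    then have "J x = (\<Sum>j<k. if j = i then f i else 0)"
      unfolding f(2) by (intro sum.cong) auto
    then show ?thesis using i f(1) by simp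
  qed
  obtain f where f: "\<And>i. i < k \<Longrightarrow> f i \<in> m_space (N i)" "x = (\<Sum>i<k. f i)"
    using direct_sum_expand[OF ds x] by blast
  have fV: "f i \<in> V" if "i < k" for i using f(1)[OF that] direct_sum_subspace(2)[OF ds that] by auto
  have "J (ricci_op M x) = J (\<Sum>i<k. c i *\<^sub>R f i)"
    using ricci_lincomb[of "{..<k}" f "\<lambda>_. 1"] fV c[OF _ f(1)] by (simp add: f(2))
  also have "\<dots> = (\<Sum>i<k. c i *\<^sub>R J (f i))"
    unfolding J_def using fV by (intro higher_jacobi_lincomb[OF W]) auto
  also have "\<dots> = (\<Sum>i<k. ricci_op M (J (f i)))"
    using c[OF _ preserves[OF _ f(1)]] by (intro sum.cong) auto
  also have "\<dots> = ricci_op M (\<Sum>i<k. J (f i))"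
    using ricci_lincomb[of "{..<k}" "\<lambda>i. J (f i)" "\<lambda>_. 1"] fV J_mem by simp
  also have "(\<Sum>i<k. J (f i)) = J x"
    unfolding f(2) J_def using fV by (intro higher_jacobi_sum[OF W, symmetric]) auto
  finally show "higher_jacobi M W (ricci_op M x) = ricci_op M (higher_jacobi M W x)"
    by (simp add: J_def)
qed

lemma zero_model_restrict:
  assumes W: "subspace W" "W \<subseteq> V"
  shows "zero_model (M\<lparr>m_space := W\<rparr>)"
proof -
  interpret W: euclidean_form W g by (rule subspace_form[OF W])
  have "inner_product_on W g"
    unfolding inner_product_on_def nondegenerate_on_def
    using W.sym W.g_pos_iff bilinear_on_left[OF W.bil] by blast
  moreover have "curvature_tensor_on W A"
  proof -
    have "multilinear4_on W A"
      using A_functional W(2) functional_on_subset[OF _ W(2)]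
      unfolding multilinear4_on_def by (simp add: subset_iff)
    moreover have "A v1 v2 v3 v4 = A v3 v4 v1 v2 \<and> A v1 v2 v3 v4 = - A v2 v1 v3 v4 \<and>
        A v1 v2 v3 v4 + A v2 v3 v1 v4 + A v3 v1 v2 v4 = 0"
      if "v1 \<in> W" "v2 \<in> W" "v3 \<in> W" "v4 \<in> W" for v1 v2 v3 v4
      using zero_model that W(2) unfolding zero_model_def curvature_tensor_on_def by blast
    ultimately show ?thesis unfolding curvature_tensor_on_def by blast
  qed
  ultimately show ?thesis using W(1) W.fin_dim by (simp add: zero_model_def)
qed

text \<open>The summands are the eigenspaces of the Ricci operator, enumerated by \<open>ev\<close>.\<close>

lemma puffini_videv_imp_direct_sum_einstein:
  assumes pv: "puffini_videv M"
  shows "\<exists>k N. k \<ge> 1 \<and> is_direct_sum M k N \<and> (\<forall>i<k. zero_model (N i) \<and> einstein (N i))"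
proof -
  obtain E l where E: "orthonormal_basis g E V" "\<And>e. e \<in> E \<Longrightarrow> e \<in> eigenspace (l e)"
    using ricci_eigenbasis by blast
  have EV: "finite E" "E \<subseteq> V" using E(1) onb_subset[OF E(1)] by (auto simp: orthonormal_basis_def)
  \<comment> \<open>Adding \<open>0\<close> guarantees \<open>k \<ge> 1\<close> even for \<open>V = {0}\<close>; if \<open>0\<close> is not an eigenvalue, it
    contributes the summand \<open>{0}\<close>.\<close>
  define L where "L = insert 0 (l ` E)"
  define k where "k = card L"
  have "finite L" using EV by (simp add: L_def)
  then obtain ev where ev: "bij_betw ev {0..<k} L"
    unfolding k_def using ex_bij_betw_nat_finite by blast
  have "k \<ge> 1" using \<open>finite L\<close> by (simp add: k_def L_def card_gt_0_iff Suc_le_eq)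
  have ev_inj: "ev i \<noteq> ev j" if "i < k" "j < k" "i \<noteq> j" for i j
    using ev that by (auto simp: bij_betw_def inj_on_def)
  define N where "N i = M\<lparr>m_space := eigenspace (ev i)\<rparr>" for i
  have N: "m_space (N i) = eigenspace (ev i)" "m_inner (N i) = g" "m_tensor (N i) = A" for i
    by (simp_all add: N_def)
  have orth: "g x y = 0" if "i < k" "j < k" "i \<noteq> j" "x \<in> m_space (N i)" "y \<in> m_space (N j)" for i j x y
    using that ev_inj eigenspace_orthogonal unfolding N by blast
  have unique: "\<exists>!f. f \<in> (\<Pi>\<^sub>E i\<in>{..<k}. m_space (N i)) \<and> x = (\<Sum>i<k. f i)" if x: "x \<in> V" for x
  proof (rule ex_ex1I)
    define f where "f = (\<lambda>i\<in>{..<k}. \<Sum>e\<in>{e\<in>E. l e = ev i}. g x e *\<^sub>R e)"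
    have "f \<in> (\<Pi>\<^sub>E i\<in>{..<k}. m_space (N i))"
    proof
      fix i assume "i \<in> {..<k}"
      moreover have "e \<in> eigenspace (ev i)" if "e \<in> E" "l e = ev i" for e
        using E(2)[OF that(1)] that(2) by simp
      ultimately show "f i \<in> m_space (N i)"
        unfolding f_def N
        by (auto intro!: subspace_sum[OF subspace_eigenspace] subspace_scale[OF subspace_eigenspace])
    qed (simp add: f_def)
    moreover have "x = (\<Sum>i<k. f i)"
    proof -
      have "(\<Sum>i<k. f i) = (\<Sum>i\<in>{0..<k}. \<Sum>e\<in>{e\<in>E. l e = ev i}. g x e *\<^sub>R e)"
        by (intro sum.cong) (auto simp: f_def)
      also have "\<dots> = (\<Sum>c\<in>L. \<Sum>e\<in>{e\<in>E. l e = c}. g x e *\<^sub>R e)"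
        by (rule sum.reindex_bij_betw[OF ev])
      also have "\<dots> = (\<Sum>e\<in>E. g x e *\<^sub>R e)"
        using EV(1) \<open>finite L\<close> by (intro sum.group) (auto simp: L_def)
      finally show ?thesis using onb_expand[OF E(1) x] by simp
    qed
    ultimately show "\<exists>f. f \<in> (\<Pi>\<^sub>E i\<in>{..<k}. m_space (N i)) \<and> x = (\<Sum>i<k. f i)" by blast
  next
    fix f h
    assume f: "f \<in> (\<Pi>\<^sub>E i\<in>{..<k}. m_space (N i)) \<and> x = (\<Sum>i<k. f i)"
      and h: "h \<in> (\<Pi>\<^sub>E i\<in>{..<k}. m_space (N i)) \<and> x = (\<Sum>i<k. h i)"
    show "f = h"
    proof (rule PiE_ext[OF f[THEN conjunct1] h[THEN conjunct1]])
      fix j assume "j \<in> {..<k}"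
      then have j: "j < k" by simp
      define d where "d i = f i - h i" for i
      have d: "d i \<in> m_space (N i)" if "i < k" for i
      proof -
        have "f i \<in> m_space (N i)" "h i \<in> m_space (N i)" using f h that by auto
        then show ?thesis unfolding d_def N by (rule subspace_diff[OF subspace_eigenspace])
      qed
      have dV: "d i \<in> V" if "i < k" for i using d[OF that] eigenspace_subset unfolding N by blast
      have "(\<Sum>i<k. d i) = x - x"
        unfolding d_def sum_subtractf using f h by simp
      then have "0 = g (\<Sum>i<k. d i) (d j)" using g_zero[OF dV[OF j]] by simp
      also have "\<dots> = (\<Sum>i<k. g (d i) (d j))" using dV j by (intro g_sum) auto
      also have "\<dots> = (\<Sum>i<k. if i = j then g (d j) (d j) else 0)"
        using orth[OF _ j _ d d[OF j]] by (intro sum.cong) auto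
      also have "\<dots> = g (d j) (d j)" using j by simp
      finally have "d j = 0" using g_pos_iff[OF dV[OF j]] by simp
      then show "f j = h j" by (simp add: d_def)
    qed
  qed
  have mixed: "A x1 x2 x3 x4 = 0"
    if "i1 < k" "i2 < k" "i3 < k" "i4 < k" "\<not> (i1 = i2 \<and> i2 = i3 \<and> i3 = i4)"
      "x1 \<in> m_space (N i1)" "x2 \<in> m_space (N i2)" "x3 \<in> m_space (N i3)" "x4 \<in> m_space (N i4)"
    for i1 i2 i3 i4 x1 x2 x3 x4
  proof -
    have "\<not> (ev i1 = ev i2 \<and> ev i2 = ev i3 \<and> ev i3 = ev i4)" using that ev_inj by metis
    then show ?thesis using curvature_mixed[OF pv] that unfolding N by blast
  qed
  have ds: "is_direct_sum M k N"
    unfolding is_direct_sum_def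
  proof (intro conjI)
    show "\<forall>i<k. subspace (m_space (N i)) \<and> m_space (N i) \<subseteq> V"
      using subspace_eigenspace eigenspace_subset by (simp add: N)
    show "\<forall>x\<in>V. \<exists>!f. f \<in> (\<Pi>\<^sub>E i\<in>{..<k}. m_space (N i)) \<and> x = (\<Sum>i<k. f i)"
      by (intro ballI unique)
    show "\<forall>i<k. \<forall>j<k. i \<noteq> j \<longrightarrow> (\<forall>x\<in>m_space (N i). \<forall>y\<in>m_space (N j). g x y = 0)"
      by (intro allI impI ballI) (rule orth)
    show "\<forall>i1<k. \<forall>i2<k. \<forall>i3<k. \<forall>i4<k. \<not> (i1 = i2 \<and> i2 = i3 \<and> i3 = i4) \<longrightarrow>
        (\<forall>x1\<in>m_space (N i1). \<forall>x2\<in>m_space (N i2). \<forall>x3\<in>m_space (N i3). \<forall>x4\<in>m_space (N i4).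
           A x1 x2 x3 x4 = 0)"
      by (intro allI impI ballI) (rule mixed)
  qed (simp_all add: N)
  have zm: "zero_model (N i)" for i
    unfolding N_def by (rule zero_model_restrict[OF subspace_eigenspace eigenspace_subset])
  have "einstein (N i)" if "i < k" for i
    unfolding einstein_def
  proof (intro exI ballI)
    fix x assume x: "x \<in> m_space (N i)"
    then have "ricci_op M x = ev i *\<^sub>R x" by (simp add: N eigenspace_def)
    then show "ricci_op (N i) x = ev i *\<^sub>R x" using direct_sum_ricci[OF ds that zm x] by simp
  qed
  then show ?thesis using \<open>k \<ge> 1\<close> ds zm by blast
qed

end

theorem theorem1p2:
  fixes M :: "'a::real_vector model"
  assumes "zero_model M" and "riemannian M"
  shows "puffini_videv M \<longleftrightarrow>
    (\<exists>(k::nat) (N :: nat \<Rightarrow> 'a model). k \<ge> 1 \<and> is_direct_sum M k N \<and>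
       (\<forall>i<k. zero_model (N i) \<and> einstein (N i)))"
proof -
  interpret riemannian_model M using assms by unfold_locales
  show ?thesis
    using puffini_videv_imp_direct_sum_einstein direct_sum_einstein_imp_puffini_videv by blast
qed

end
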